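(* Let $2\le n<\infty$. For $z,y\in\bigcup_{m\ge 1}(\mathcal{V}_{n,m})_1$, assume that both $z$ and $y$ are nonperiodic. Then the following are equivalent: (i) The GNS representations of $\mathcal{O}_n$ by $\tilde{\omega}_z$ and $\tilde{\omega}_y$ are unitarily equivalent. (ii) Either (a) $z=y$, or (b) $z=x_1\otimes x_2$ and $y=x_2\otimes x_1$ for some $x_1,x_2\in\bigcup_{m\ge 1}(\mathcal{V}_{n,m})_1$.
   Context: $\mathcal{O}_n$ ($2\le n<\infty$) is the Cuntz algebra, the universal C$^*$-algebra generated by $s_1,\ldots,s_n$ with $s_i^*s_j=\delta_{ij}I$ and $\sum_{i=1}^n s_is_i^*=I$. For $J=(j_1,\ldots,j_k)\in\{1,\ldots,n\}^k$, $s_J:=s_{j_1}\cdots s_{j_k}$. $\mathcal{V}_{n,m}:=\ell^2(\{1,\ldots,n\}^m)$ is the Hilbert space with orthonormal basis $\{e_J: J\in\{1,\ldots,n\}^m\}$, identified with $(\mathbb{C}^n)^{\otimes m}$ via $e_J\leftrightarrow e_{j_1}\otimes\cdots\otimes e_{j_m}$, so that $\mathcal{V}_{n,m}\otimes\mathcal{V}_{n,l}=\mathcal{V}_{n,m+l}$. $(\mathcal{V}_{n,m})_1$ is the set of unit vectors. For $z=\sum z_Je_J\in(\mathcal{V}_{n,m})_1$, a sub-Cuntz state on $\mathcal{O}_n$ by $z$ is a state $\omega$ on $\mathcal{O}_n$ with $\omega(s_J)=\overline{z_J}$ for all $J\in\{1,\ldots,n\}^m$. $z$ is nonperiodic if $z=x^{\otimes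 p}$ for some $p\ge 1$ and some $x\in\bigcup_{k\ge1}\mathcal{V}_{n,k}$ implies $p=1$. For a nonperiodic unit vector $z$ there is exactly one sub-Cuntz state by $z$, denoted $\tilde{\omega}_z$. *)

theory Defs
  imports "HOL-Analysis.Analysis" "HOL-Library.Poly_Mapping"
begin

section \<open>Complex Hilbert spaces and unital C*-algebras\<close>

class scaleC = scaleR +
  fixes scaleC :: "complex \<Rightarrow> 'a \<Rightarrow> 'a"  (infixr \<open>*\<^sub>C\<close> 75)

class complex_vector = real_vector + scaleC +
  assumes scaleC_add_right: "c *\<^sub>C (x + y) = c *\<^sub>C x + c *\<^sub>C y"
    and scaleC_add_left: "(c + d) *\<^sub>C x = c *\<^sub>C x + d *\<^sub>C x"
    and scaleC_scaleC: "c *\<^sub>C d *\<^sub>C x = (c * d) *\<^sub>C x"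
    and scaleC_one: "1 *\<^sub>C x = x"
    and scaleR_scaleC: "r *\<^sub>R x = complex_of_real r *\<^sub>C x"

text \<open>The inner product is conjugate-linear in the first and linear in the second argument.\<close>

class chilbert_space = complex_vector + real_normed_vector + complete_space +
  fixes cinner :: "'a \<Rightarrow> 'a \<Rightarrow> complex"
  assumes cinner_commute: "cinner x y = cnj (cinner y x)"
    and cinner_add_right: "cinner x (y + z) = cinner x y + cinner x z"
    and cinner_scaleC_right: "cinner x (c *\<^sub>C y) = c * cinner x y"
    and cinner_self: "cinner x x = complex_of_real ((norm x)\<^sup>2)"

text \<open>The zero algebra is not excluded (\<open>1 \<noteq> 0\<close> is not an axiom); it carries no state.\<close>

class cstar_algebra = real_normed_algebra + monoid_mult + complete_space + complex_vector +
  fixes star :: "'a \<Rightarrow> 'a"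
  assumes scaleC_mult_left: "(c *\<^sub>C a) * b = c *\<^sub>C (a * b)"
    and scaleC_mult_right: "a * (c *\<^sub>C b) = c *\<^sub>C (a * b)"
    and norm_scaleC: "norm (c *\<^sub>C a) = cmod c * norm a"
    and star_star: "star (star a) = a"
    and star_add: "star (a + b) = star a + star b"
    and star_mult: "star (a * b) = star b * star a"
    and star_scaleC: "star (c *\<^sub>C a) = cnj c *\<^sub>C star a"
    and cstar_identity: "norm (star a * a) = (norm a)\<^sup>2"

definition is_state :: "('a::cstar_algebra \<Rightarrow> complex) \<Rightarrow> bool" where
  "is_state \<omega> \<longleftrightarrow>
     (\<forall>a b. \<omega> (a + b) = \<omega> a + \<omega> b) \<and>
     (\<forall>c a. \<omega> (c *\<^sub>C a) = c * \<omega> a) \<and>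
     (\<forall>a. \<omega> (star a * a) \<in> \<real>\<^sub>\<ge>\<^sub>0) \<and>
     \<omega> 1 = 1"

definition star_representation :: "('a::cstar_algebra \<Rightarrow> 'h::chilbert_space \<Rightarrow> 'h) \<Rightarrow> bool" where
  "star_representation \<pi> \<longleftrightarrow>
     (\<forall>a. bounded_linear (\<pi> a)) \<and>
     (\<forall>a c v. \<pi> a (c *\<^sub>C v) = c *\<^sub>C \<pi> a v) \<and>
     (\<forall>a b v. \<pi> (a + b) v = \<pi> a v + \<pi> b v) \<and>
     (\<forall>c a v. \<pi> (c *\<^sub>C a) v = c *\<^sub>C \<pi> a v) \<and>
     (\<forall>a b v. \<pi> (a * b) v = \<pi> a (\<pi> b v)) \<and>
     (\<forall>v. \<pi> 1 v = v) \<and>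
     (\<forall>a v w. cinner (\<pi> (star a) v) w = cinner v (\<pi> a w))"

text \<open>\<open>(\<pi>, \<Omega>)\<close>, on the Hilbert space \<open>'h\<close>, is a GNS triple of \<open>\<omega>\<close>: a cyclic representation
  whose cyclic vector implements \<open>\<omega>\<close>.  By the GNS theorem it exists and is unique
  up to unitary equivalence.\<close>

definition gns_triple ::
  "('a::cstar_algebra \<Rightarrow> complex) \<Rightarrow> ('a \<Rightarrow> 'h::chilbert_space \<Rightarrow> 'h) \<Rightarrow> 'h \<Rightarrow> bool" where
  "gns_triple \<omega> \<pi> \<Omega> \<longleftrightarrow>
     star_representation \<pi> \<and>
     closure (range (\<lambda>a. \<pi> a \<Omega>)) = UNIV \<and>
     (\<forall>a. \<omega> a = cinner \<Omega> (\<pi> a \<Omega>))"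

definition unitary :: "('h::chilbert_space \<Rightarrow> 'k::chilbert_space) \<Rightarrow> bool" where
  "unitary U \<longleftrightarrow>
     (\<forall>v w. U (v + w) = U v + U w) \<and>
     (\<forall>c v. U (c *\<^sub>C v) = c *\<^sub>C U v) \<and>
     (\<forall>v w. cinner (U v) (U w) = cinner v w) \<and>
     surj U"

definition unitarily_equivalent ::
  "('a::cstar_algebra \<Rightarrow> 'h::chilbert_space \<Rightarrow> 'h) \<Rightarrow> ('a \<Rightarrow> 'k::chilbert_space \<Rightarrow> 'k) \<Rightarrow> bool" where
  "unitarily_equivalent \<pi> \<rho> \<longleftrightarrow> (\<exists>U. unitary U \<and> (\<forall>a v. U (\<pi> a v) = \<rho> a (U v)))"

section \<open>The free unital *-algebra on \<open>'n\<close>\<close>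

text \<open>Words in the letters \<open>s\<^sub>i\<close> and \<open>s\<^sub>i\<^sup>*\<close>.  They are written as an additive monoid because
  \<^type>\<open>poly_mapping\<close> provides the convolution product for such exponents.\<close>

datatype 'n letter = Gen 'n | GenStar 'n

datatype 'n word = Word "'n letter list"

instantiation word :: (type) monoid_add
begin

definition "0 = Word []"

fun plus_word :: "'a word \<Rightarrow> 'a word \<Rightarrow> 'a word" where
  "Word u + Word v = Word (u @ v)"

instance
proof
  fix a b c :: "'a word"
  show "a + b + c = a + (b + c)" by (cases a; cases b; cases c) simp
  show "0 + a = a" "a + 0 = a" by (cases a; simp add: zero_word_def)+
qed

end

fun letter_star :: "'n letter \<Rightarrow> 'n letter" where
  "letter_star (Gen i) = GenStar i"
| "letter_star (GenStar i) = Gen i"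

fun word_star :: "'n word \<Rightarrow> 'n word" where
  "word_star (Word u) = Word (rev (map letter_star u))"

type_synonym 'n free = "'n word \<Rightarrow>\<^sub>0 complex"

definition fscale :: "complex \<Rightarrow> 'n free \<Rightarrow> 'n free" where
  "fscale c a = Poly_Mapping.single 0 c * a"

definition fstar :: "'n free \<Rightarrow> 'n free" where
  "fstar a = Poly_Mapping.map cnj (Poly_Mapping.map_key word_star a)"

definition fgen :: "'n \<Rightarrow> 'n free" where
  "fgen i = Poly_Mapping.single (Word [Gen i]) 1"

lemma letter_star_letter_star [simp]: "letter_star (letter_star l) = l"
  by (cases l) auto

lemma word_star_word_star [simp]: "word_star (word_star w) = w"
  by (cases w) (simp add: rev_map comp_def)

lemma word_star_add: "word_star (v + w) = word_star w + word_star v"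
  by (cases v; cases w) simp

lemma word_star_zero [simp]: "word_star 0 = 0"
  by (simp add: zero_word_def)

lemma inj_word_star: "inj word_star"
  by (metis injI word_star_word_star)

lemma free_induct [case_names zero single add]:
  fixes a :: "'k \<Rightarrow>\<^sub>0 'c::comm_monoid_add"
  assumes "P 0" and "\<And>w c. P (Poly_Mapping.single w c)" and "\<And>a b. P a \<Longrightarrow> P b \<Longrightarrow> P (a + b)"
  shows "P a"
proof (induction a rule: Poly_Mapping.update_induct)
  case const
  show ?case by fact
next
  case (update f k c)
  have "Poly_Mapping.update k c f = f + Poly_Mapping.single k c"
    using update(1)
    by (intro poly_mapping_eqI)
       (auto simp: lookup_update lookup_add lookup_single when_def in_keys_iff)
  then show ?case using update assms by metis
qed

lemma lookup_fstar: "Poly_Mapping.lookup (fstar a) w = cnj (Poly_Mapping.lookup a (word_star w))"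
  by (auto simp: fstar_def map.rep_eq map_key.rep_eq[OF inj_word_star] when_def)

lemma fstar_single: "fstar (Poly_Mapping.single w c) = Poly_Mapping.single (word_star w) (cnj c)"
  by (rule poly_mapping_eqI) (auto simp: lookup_fstar lookup_single when_def)

lemma fstar_add: "fstar (a + b) = fstar a + fstar b"
  by (rule poly_mapping_eqI) (auto simp: lookup_fstar lookup_add)

lemma fstar_zero [simp]: "fstar 0 = 0"
  by (rule poly_mapping_eqI) (auto simp: lookup_fstar)

lemma fstar_minus: "fstar (- a) = - fstar a"
  by (rule poly_mapping_eqI) (auto simp: lookup_fstar)

lemma fstar_diff: "fstar (a - b) = fstar a - fstar b"
  by (rule poly_mapping_eqI) (auto simp: lookup_fstar lookup_minus)

lemma fstar_fstar [simp]: "fstar (fstar a) = a"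
  by (rule poly_mapping_eqI) (auto simp: lookup_fstar)

lemma fstar_one [simp]: "fstar 1 = (1 :: 'n free)"
  using fstar_single[of "0 :: 'n word" 1] by simp

lemma fstar_mult: "fstar (a * b) = fstar b * fstar (a :: 'n free)"
proof (induction a rule: free_induct)
  case (single v c)
  show ?case
    by (induction b rule: free_induct)
       (simp_all add: fstar_add fstar_single mult_single word_star_add algebra_simps)
qed (simp_all add: fstar_add algebra_simps)

lemma single_zero_commute: "a * Poly_Mapping.single 0 c = Poly_Mapping.single 0 c * (a :: 'n free)"
  by (induction a rule: free_induct) (simp_all add: mult_single algebra_simps)

lemma fscale_mult_left: "fscale c a * b = fscale c (a * b)"
  by (simp add: fscale_def mult.assoc)

lemma fscale_mult_right: "a * fscale c b = fscale c (a * b)"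
  unfolding fscale_def by (metis mult.assoc single_zero_commute)

lemma fscale_add: "fscale c (a + b) = fscale c a + fscale c b"
  by (simp add: fscale_def algebra_simps)

lemma fscale_diff: "fscale c (a - b) = fscale c a - fscale c b"
  by (simp add: fscale_def algebra_simps)

lemma fscale_add_left: "fscale (c + d) a = fscale c a + fscale d a"
  by (simp add: fscale_def single_add algebra_simps)

lemma fscale_fscale: "fscale c (fscale d a) = fscale (c * d) a"
  by (simp add: fscale_def mult.assoc[symmetric] mult_single)

lemma fscale_one: "fscale 1 a = a"
  by (simp add: fscale_def)

lemma fscale_zero: "fscale 0 a = 0"
  by (simp add: fscale_def)

lemma fscale_minus_one: "fscale (- 1) a = - a"
  by (simp add: fscale_def single_uminus)

lemma fscale_single: "fscale c (Poly_Mapping.single w d) = Poly_Mapping.single w (c * d)"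
  by (simp add: fscale_def mult_single)

lemma fstar_fscale: "fstar (fscale c a) = fscale (cnj c) (fstar a)"
  by (simp add: fscale_def fstar_mult fstar_single single_zero_commute)

section \<open>The universal C*-seminorm of the Cuntz relations\<close>

definition cuntz_seminorm :: "('n::finite free \<Rightarrow> real) \<Rightarrow> bool" where
  "cuntz_seminorm p \<longleftrightarrow>
     (\<forall>a b. p (a + b) \<le> p a + p b) \<and>
     (\<forall>c a. p (fscale c a) = cmod c * p a) \<and>
     (\<forall>a b. p (a * b) \<le> p a * p b) \<and>
     (\<forall>a. p (fstar a * a) = (p a)\<^sup>2) \<and>
     (\<forall>i j. p (fstar (fgen i) * fgen j - (if i = j then 1 else 0)) = 0) \<and>
     p ((\<Sum>i\<in>UNIV. fgen i * fstar (fgen i)) - 1) = 0"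

definition fnorm :: "'n::finite free \<Rightarrow> real" where
  "fnorm a = (SUP p\<in>Collect cuntz_seminorm. p a)"

context
  fixes p :: "'n::finite free \<Rightarrow> real"
  assumes p: "cuntz_seminorm p"
begin

lemma cs_add: "p (a + b) \<le> p a + p b"
  and cs_scale: "p (fscale c a) = cmod c * p a"
  and cs_mult: "p (a * b) \<le> p a * p b"
  and cs_cstar: "p (fstar a * a) = (p a)\<^sup>2"
  and cs_rel1: "p (fstar (fgen i) * fgen j - (if i = j then 1 else 0)) = 0"
  and cs_rel2: "p ((\<Sum>i\<in>UNIV. fgen i * fstar (fgen i)) - 1) = 0"
  using p unfolding cuntz_seminorm_def by blast+

lemma cs_zero: "p 0 = 0"
  using cs_scale[of 0 0] by (simp add: fscale_zero)

lemma cs_minus: "p (- a) = p a"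
  using cs_scale[of "-1" a] by (simp add: fscale_minus_one)

lemma cs_nonneg: "0 \<le> p a"
  using cs_add[of a "- a"] by (simp add: cs_zero cs_minus)

lemma cs_star: "p (fstar a) = p a"
proof -
  have le: "p b \<le> p (fstar b)" for b
  proof (cases "p b = 0")
    case False
    have "p b * p b \<le> p (fstar b) * p b"
      using cs_cstar[of b] cs_mult[of "fstar b" b] by (simp add: power2_eq_square)
    with False cs_nonneg[of b] show ?thesis by simp
  qed (simp add: cs_nonneg)
  from le[of a] le[of "fstar a"] show ?thesis by simp
qed

lemma cs_one: "p 1 \<le> 1"
proof -
  have "p 1 = p 1 * p 1" using cs_cstar[of 1] by (simp add: power2_eq_square)
  then show ?thesis by (cases "p 1 = 0") auto
qed

lemma cs_fgen: "p (fgen i) \<le> 1"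
proof -
  have "p (fstar (fgen i) * fgen i) \<le> p (fstar (fgen i) * fgen i - 1) + p 1"
    using cs_add[of "fstar (fgen i) * fgen i - 1" 1] by simp
  also have "\<dots> \<le> 1" using cs_rel1[of i i] cs_one by simp
  finally have "(p (fgen i))\<^sup>2 \<le> 1" by (simp add: cs_cstar)
  then show ?thesis using power2_le_imp_le[of "p (fgen i)" 1] by simp
qed

lemma cs_word: "p (Poly_Mapping.single (Word u) 1) \<le> 1"
proof (induction u)
  case Nil
  then show ?case using cs_one by (simp flip: zero_word_def)
next
  case (Cons l u)
  have "Poly_Mapping.single (Word (l # u)) 1
      = Poly_Mapping.single (Word [l]) 1 * Poly_Mapping.single (Word u) (1::complex)"
    by (simp add: mult_single)
  moreover have "p (Poly_Mapping.single (Word [l]) 1) \<le> 1"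
  proof (cases l)
    case (Gen i)
    then show ?thesis using cs_fgen[of i] by (simp add: fgen_def)
  next
    case (GenStar i)
    then have "Poly_Mapping.single (Word [l]) 1 = fstar (fgen i)"
      by (simp add: fgen_def fstar_single)
    then show ?thesis using cs_fgen[of i] by (simp add: cs_star)
  qed
  ultimately show ?case
    using cs_mult[of "Poly_Mapping.single (Word [l]) 1" "Poly_Mapping.single (Word u) 1"] Cons
    by (smt (verit) cs_nonneg mult_le_one)
qed

end

lemma cuntz_seminorm_zero: "cuntz_seminorm (\<lambda>_. 0)"
  by (simp add: cuntz_seminorm_def)

lemma cuntz_seminorm_bounded: "\<exists>B. \<forall>p. cuntz_seminorm p \<longrightarrow> p a \<le> B"
proof (induction a rule: free_induct)
  case zero
  show ?case by (rule exI[of _ 0]) (simp add: cs_zero)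
next
  case (single w c)
  obtain u where w: "w = Word u" by (cases w)
  have "p (Poly_Mapping.single w c) \<le> cmod c" if "cuntz_seminorm p" for p
  proof -
    have "p (Poly_Mapping.single w c) = cmod c * p (Poly_Mapping.single w 1)"
      using cs_scale[OF that, of c "Poly_Mapping.single w 1"] by (simp add: fscale_single)
    also have "\<dots> \<le> cmod c"
      using cs_word[OF that, of u] by (simp add: w mult_left_le)
    finally show ?thesis .
  qed
  then show ?case by blast
next
  case (add a b)
  then obtain A B where "\<forall>p. cuntz_seminorm p \<longrightarrow> p a \<le> A" "\<forall>p. cuntz_seminorm p \<longrightarrow> p b \<le> B"
    by blast
  then have "\<forall>p. cuntz_seminorm p \<longrightarrow> p (a + b) \<le> A + B"
    by (meson add_mono cs_add order_trans)
  then show ?case by blast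
qed

lemma fnorm_upper: "cuntz_seminorm p \<Longrightarrow> p a \<le> fnorm a"
  unfolding fnorm_def
  using cuntz_seminorm_bounded[of a] by (intro cSUP_upper) (auto simp: bdd_above_def)

lemma fnorm_least: "(\<And>p. cuntz_seminorm p \<Longrightarrow> p a \<le> B) \<Longrightarrow> fnorm a \<le> B"
  unfolding fnorm_def using cuntz_seminorm_zero by (intro cSUP_least) auto

lemma fnorm_nonneg0: "0 \<le> fnorm a"
  using fnorm_upper[OF cuntz_seminorm_zero] .

lemma cuntz_seminorm_fnorm: "cuntz_seminorm (fnorm :: 'n::finite free \<Rightarrow> real)"
proof -
  have add: "fnorm (a + b) \<le> fnorm a + fnorm b" for a b :: "'n free"
    by (rule fnorm_least) (meson add_mono cs_add fnorm_upper order_trans)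
  have scale_le: "fnorm (fscale c a) \<le> cmod c * fnorm a" for c and a :: "'n free"
    by (rule fnorm_least) (simp add: cs_scale fnorm_upper mult_left_mono)
  have scale: "fnorm (fscale c a) = cmod c * fnorm a" for c and a :: "'n free"
  proof (cases "c = 0")
    case True
    then show ?thesis using scale_le[of c a] fnorm_nonneg0[of "fscale c a"] by simp
  next
    case False
    then have "fnorm a \<le> cmod (inverse c) * fnorm (fscale c a)"
      using scale_le[of "inverse c" "fscale c a"] by (simp add: fscale_fscale fscale_one)
    with False have "cmod c * fnorm a \<le> fnorm (fscale c a)"
      by (simp add: norm_inverse norm_divide field_simps)
    with scale_le[of c a] show ?thesis by simp
  qed
  have mult: "fnorm (a * b) \<le> fnorm a * fnorm b" for a b :: "'n free"
  proof (rule fnorm_least)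
    fix p :: "'n free \<Rightarrow> real" assume p: "cuntz_seminorm p"
    have "p (a * b) \<le> p a * p b" by (rule cs_mult[OF p])
    also have "\<dots> \<le> fnorm a * fnorm b"
      by (intro mult_mono fnorm_upper p cs_nonneg[OF p] fnorm_nonneg0)
    finally show "p (a * b) \<le> fnorm a * fnorm b" .
  qed
  have cstar: "fnorm (fstar a * a) = (fnorm a)\<^sup>2" for a :: "'n free"
  proof (rule antisym)
    show "fnorm (fstar a * a) \<le> (fnorm a)\<^sup>2"
      by (rule fnorm_least) (simp add: cs_cstar cs_nonneg fnorm_upper power_mono)
    have "fnorm a \<le> sqrt (fnorm (fstar a * a))"
      by (rule fnorm_least) (metis cs_cstar fnorm_upper real_le_rsqrt)
    then show "(fnorm a)\<^sup>2 \<le> fnorm (fstar a * a)"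
      by (metis fnorm_nonneg0 power_mono real_sqrt_pow2)
  qed
  have null: "fnorm a = 0" if "\<And>p. cuntz_seminorm p \<Longrightarrow> p a = 0" for a :: "'n free"
    using that by (metis antisym fnorm_least fnorm_nonneg0 order_refl)
  show ?thesis
    unfolding cuntz_seminorm_def
    by (intro conjI allI add scale mult cstar null) (erule cs_rel1 cs_rel2)+
qed

lemmas fnorm_add = cs_add[OF cuntz_seminorm_fnorm]
  and fnorm_scale = cs_scale[OF cuntz_seminorm_fnorm]
  and fnorm_mult = cs_mult[OF cuntz_seminorm_fnorm]
  and fnorm_cstar = cs_cstar[OF cuntz_seminorm_fnorm]
  and fnorm_rel1 = cs_rel1[OF cuntz_seminorm_fnorm]
  and fnorm_rel2 = cs_rel2[OF cuntz_seminorm_fnorm]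
  and fnorm_zero [simp] = cs_zero[OF cuntz_seminorm_fnorm]
  and fnorm_minus [simp] = cs_minus[OF cuntz_seminorm_fnorm]
  and fnorm_nonneg [simp] = cs_nonneg[OF cuntz_seminorm_fnorm]
  and fnorm_star = cs_star[OF cuntz_seminorm_fnorm]

lemma fnorm_diff_commute: "fnorm (a - b) = fnorm (b - a)"
  using fnorm_minus[of "a - b"] by simp

lemma fnorm_diff_triangle: "\<bar>fnorm a - fnorm b\<bar> \<le> fnorm (a - b)"
  using fnorm_add[of "a - b" b] fnorm_add[of "b - a" a] fnorm_diff_commute[of a b] by simp

lemma fnorm_triangle3: "fnorm (a - c) \<le> fnorm (a - b) + fnorm (b - c)"
  using fnorm_add[of "a - b" "b - c"] by simp

section \<open>The Cuntz algebra\<close>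

definition fcauchy :: "(nat \<Rightarrow> 'n::finite free) \<Rightarrow> bool" where
  "fcauchy X \<longleftrightarrow> (\<forall>e>0. \<exists>M. \<forall>k\<ge>M. \<forall>l\<ge>M. fnorm (X k - X l) < e)"

definition fequiv :: "(nat \<Rightarrow> 'n::finite free) \<Rightarrow> (nat \<Rightarrow> 'n free) \<Rightarrow> bool" where
  "fequiv X Y \<longleftrightarrow> fcauchy X \<and> fcauchy Y \<and> (\<lambda>k. fnorm (X k - Y k)) \<longlonglongrightarrow> 0"

lemma fcauchyD: "fcauchy X \<Longrightarrow> e > 0 \<Longrightarrow> \<exists>M. \<forall>k\<ge>M. \<forall>l\<ge>M. fnorm (X k - X l) < e"
  unfolding fcauchy_def by blast

lemma null_le:
  fixes f g :: "nat \<Rightarrow> real"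
  assumes "g \<longlonglongrightarrow> 0" and "\<And>k. 0 \<le> f k" and "\<And>k. f k \<le> g k"
  shows "f \<longlonglongrightarrow> 0"
  using tendsto_sandwich[of "\<lambda>_. 0" f sequentially g 0] assms by simp

lemma Cauchy_diff:
  fixes X Y :: "nat \<Rightarrow> 'a::real_normed_vector"
  assumes "Cauchy X" "Cauchy Y"
  shows "Cauchy (\<lambda>k. X k - Y k)"
proof (rule CauchyI)
  fix e :: real assume "e > 0"
  then have "e/2 > 0" by simp
  from CauchyD[OF assms(1) this] CauchyD[OF assms(2) this] obtain M N where
    M: "\<And>k l. k \<ge> M \<Longrightarrow> l \<ge> M \<Longrightarrow> norm (X k - X l) < e/2" and
    N: "\<And>k l. k \<ge> N \<Longrightarrow> l \<ge> N \<Longrightarrow> norm (Y k - Y l) < e/2" by blast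
  have "norm ((X k - Y k) - (X l - Y l)) < e" if "k \<ge> max M N" "l \<ge> max M N" for k l
    using norm_triangle_ineq4[of "X k - X l" "Y k - Y l"] M[of k l] N[of k l] that
    by (simp add: algebra_simps)
  then show "\<exists>M. \<forall>k\<ge>M. \<forall>l\<ge>M. norm ((X k - Y k) - (X l - Y l)) < e" by blast
qed

lemma fcauchy_const: "fcauchy (\<lambda>_. a)"
  by (simp add: fcauchy_def)

lemma fcauchy_lipschitz:
  assumes "fcauchy X" and "\<And>k l. fnorm (Y k - Y l) \<le> C * fnorm (X k - X l)"
  shows "fcauchy Y"
  unfolding fcauchy_def
proof (intro allI impI)
  fix e :: real assume "e > 0"
  define D where "D = \<bar>C\<bar> + 1"
  have D: "D > 0" "C \<le> D" by (auto simp: D_def)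
  from fcauchyD[OF assms(1), of "e / D"] \<open>e > 0\<close> D
  obtain M where M: "\<And>k l. k \<ge> M \<Longrightarrow> l \<ge> M \<Longrightarrow> fnorm (X k - X l) < e / D" by auto
  have "fnorm (Y k - Y l) < e" if "k \<ge> M" "l \<ge> M" for k l
  proof -
    have "fnorm (Y k - Y l) \<le> D * fnorm (X k - X l)"
      using assms(2)[of k l] D by (meson fnorm_nonneg mult_right_mono order_trans)
    also have "\<dots> < e" using M[OF that] D by (simp add: field_simps)
    finally show ?thesis .
  qed
  then show "\<exists>M. \<forall>k\<ge>M. \<forall>l\<ge>M. fnorm (Y k - Y l) < e" by blast
qed

lemma fcauchy_bounded:
  assumes "fcauchy X"
  shows "\<exists>B>0. \<forall>k. fnorm (X k) \<le> B"
proof -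
  from fcauchyD[OF assms, of 1] obtain M
    where M: "\<And>k l. k \<ge> M \<Longrightarrow> l \<ge> M \<Longrightarrow> fnorm (X k - X l) < 1" by auto
  define B where "B = (\<Sum>k\<le>M. fnorm (X k)) + 1"
  have "B > 0" unfolding B_def by (simp add: add_nonneg_pos sum_nonneg)
  have le: "fnorm (X k) \<le> (\<Sum>k\<le>M. fnorm (X k))" if "k \<le> M" for k
    using that by (intro member_le_sum) auto
  have "fnorm (X k) \<le> B" for k
  proof (cases "k \<le> M")
    case True
    then show ?thesis using le[of k] by (simp add: B_def)
  next
    case False
    then have "fnorm (X k - X M) < 1" by (intro M) auto
    then show ?thesis using fnorm_diff_triangle[of "X k" "X M"] le[of M] by (simp add: B_def)
  qed
  with \<open>B > 0\<close> show ?thesis by blast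
qed

lemma fcauchy_add:
  assumes "fcauchy X" "fcauchy Y"
  shows "fcauchy (\<lambda>k. X k + Y k)"
  unfolding fcauchy_def
proof (intro allI impI)
  fix e :: real assume "e > 0"
  then have "e/2 > 0" by simp
  from fcauchyD[OF assms(1) this] fcauchyD[OF assms(2) this]
  obtain M N where
    M: "\<And>k l. k \<ge> M \<Longrightarrow> l \<ge> M \<Longrightarrow> fnorm (X k - X l) < e/2" and
    N: "\<And>k l. k \<ge> N \<Longrightarrow> l \<ge> N \<Longrightarrow> fnorm (Y k - Y l) < e/2" by blast
  have "fnorm ((X k + Y k) - (X l + Y l)) < e" if "k \<ge> max M N" "l \<ge> max M N" for k l
    using fnorm_add[of "X k - X l" "Y k - Y l"] M[of k l] N[of k l] that
    by (simp add: algebra_simps)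
  then show "\<exists>M. \<forall>k\<ge>M. \<forall>l\<ge>M. fnorm ((X k + Y k) - (X l + Y l)) < e" by blast
qed

lemma fnorm_mult_diff:
  "fnorm (a * b - c * d) \<le> fnorm a * fnorm (b - d) + fnorm (a - c) * fnorm d"
proof -
  have "a * b - c * d = a * (b - d) + (a - c) * d" by (simp add: algebra_simps)
  then have "fnorm (a * b - c * d) \<le> fnorm (a * (b - d)) + fnorm ((a - c) * d)"
    by (simp add: fnorm_add)
  also have "\<dots> \<le> fnorm a * fnorm (b - d) + fnorm (a - c) * fnorm d"
    by (intro add_mono fnorm_mult)
  finally show ?thesis .
qed

lemma fcauchy_mult:
  assumes "fcauchy X" "fcauchy Y"
  shows "fcauchy (\<lambda>k. X k * Y k)"
  unfolding fcauchy_def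
proof (intro allI impI)
  fix e :: real assume "e > 0"
  obtain A where A: "A > 0" "\<And>k. fnorm (X k) \<le> A" using fcauchy_bounded[OF assms(1)] by blast
  obtain B where B: "B > 0" "\<And>k. fnorm (Y k) \<le> B" using fcauchy_bounded[OF assms(2)] by blast
  have pos: "e/(2*B) > 0" "e/(2*A) > 0" using \<open>e > 0\<close> A(1) B(1) by auto
  from fcauchyD[OF assms(1) pos(1)] fcauchyD[OF assms(2) pos(2)]
  obtain M N where
    M: "\<And>k l. k \<ge> M \<Longrightarrow> l \<ge> M \<Longrightarrow> fnorm (X k - X l) < e/(2*B)" and
    N: "\<And>k l. k \<ge> N \<Longrightarrow> l \<ge> N \<Longrightarrow> fnorm (Y k - Y l) < e/(2*A)" by blast
  have "fnorm (X k * Y k - X l * Y l) < e" if "k \<ge> max M N" "l \<ge> max M N" for k l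
  proof -
    have "fnorm (X k * Y k - X l * Y l)
        \<le> fnorm (X k) * fnorm (Y k - Y l) + fnorm (X k - X l) * fnorm (Y l)"
      by (rule fnorm_mult_diff)
    also have "\<dots> \<le> A * fnorm (Y k - Y l) + fnorm (X k - X l) * B"
      using A B by (intro add_mono mult_mono) (auto intro: less_imp_le)
    also have "\<dots> < A * (e/(2*A)) + (e/(2*B)) * B"
      using A B M[of k l] N[of k l] that
      by (intro add_strict_mono mult_strict_left_mono mult_strict_right_mono) auto
    also have "\<dots> = e" using A B by (simp add: field_simps)
    finally show ?thesis .
  qed
  then show "\<exists>M. \<forall>k\<ge>M. \<forall>l\<ge>M. fnorm (X k * Y k - X l * Y l) < e" by blast
qed

lemma fcauchy_minus: "fcauchy X \<Longrightarrow> fcauchy (\<lambda>k. - X k)"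
  by (erule fcauchy_lipschitz[where C = 1]) (simp add: fnorm_diff_commute)

lemma fcauchy_fscale: "fcauchy X \<Longrightarrow> fcauchy (\<lambda>k. fscale c (X k))"
  by (rule fcauchy_lipschitz[where C = "cmod c"]) (auto simp flip: fscale_diff simp: fnorm_scale)

lemma fcauchy_fstar: "fcauchy X \<Longrightarrow> fcauchy (\<lambda>k. fstar (X k))"
  by (rule fcauchy_lipschitz[where C = 1]) (auto simp flip: fstar_diff simp: fnorm_star)

lemma fcauchy_fnorm_convergent:
  assumes "fcauchy X"
  shows "convergent (\<lambda>k. fnorm (X k))"
  unfolding Cauchy_convergent_iff[symmetric]
proof (rule CauchyI)
  fix e :: real assume "e > 0"
  from fcauchyD[OF assms this] obtain M
    where M: "\<And>k l. k \<ge> M \<Longrightarrow> l \<ge> M \<Longrightarrow> fnorm (X k - X l) < e" by blast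
  have "norm (fnorm (X k) - fnorm (X l)) < e" if "k \<ge> M" "l \<ge> M" for k l
    using fnorm_diff_triangle[of "X k" "X l"] M[OF that] by simp
  then show "\<exists>M. \<forall>k\<ge>M. \<forall>l\<ge>M. norm (fnorm (X k) - fnorm (X l)) < e" by blast
qed

lemma fcauchy_fnorm_LIMSEQ: "fcauchy X \<Longrightarrow> (\<lambda>k. fnorm (X k)) \<longlonglongrightarrow> lim (\<lambda>k. fnorm (X k))"
  using fcauchy_fnorm_convergent convergent_LIMSEQ_iff by blast

lemma fequiv_refl: "fcauchy X \<Longrightarrow> fequiv X X"
  by (simp add: fequiv_def)

lemma part_equivp_fequiv: "part_equivp fequiv"
proof (rule part_equivpI)
  show "\<exists>X. fequiv X X" using fequiv_refl fcauchy_const by blast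
  show "symp fequiv" by (auto simp: symp_def fequiv_def fnorm_diff_commute)
  show "transp fequiv"
  proof (rule transpI)
    fix X Y Z :: "nat \<Rightarrow> 'n::finite free"
    assume XY: "fequiv X Y" and YZ: "fequiv Y Z"
    then have "(\<lambda>k. fnorm (X k - Y k) + fnorm (Y k - Z k)) \<longlonglongrightarrow> 0"
      unfolding fequiv_def by (auto intro: tendsto_add_zero)
    then have "(\<lambda>k. fnorm (X k - Z k)) \<longlonglongrightarrow> 0"
      by (rule null_le) (auto intro: fnorm_triangle3)
    with XY YZ show "fequiv X Z" by (simp add: fequiv_def)
  qed
qed

text \<open>The universal unital C*-algebra on the generators \<open>s\<^sub>i\<close> subject to the Cuntz relations: the
  (separation) completion of the free *-algebra for its largest C*-seminorm respecting the
  relations.  The universal property is \<open>cuntz_universal\<close> below.\<close>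

quotient_type (overloaded) 'n cuntz = "nat \<Rightarrow> 'n::finite free" / partial: fequiv
  morphisms rep_cuntz abs_cuntz
  by (rule part_equivp_fequiv)

lemma fequivD:
  assumes "fequiv X Y"
  shows "fcauchy X" "fcauchy Y" "(\<lambda>k. fnorm (X k - Y k)) \<longlonglongrightarrow> 0"
  using assms by (auto simp: fequiv_def)

lemma fequiv_lipschitz:
  assumes "fequiv X Y" and "fcauchy X'" "fcauchy Y'"
    and "\<And>k. fnorm (X' k - Y' k) \<le> C * fnorm (X k - Y k)"
  shows "fequiv X' Y'"
proof -
  have "(\<lambda>k. C * fnorm (X k - Y k)) \<longlonglongrightarrow> 0"
    using fequivD(3)[OF assms(1)] by (rule tendsto_mult_right_zero)
  then have "(\<lambda>k. fnorm (X' k - Y' k)) \<longlonglongrightarrow> 0"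
    by (rule null_le) (use assms in auto)
  with assms show ?thesis by (simp add: fequiv_def)
qed

lemma fequiv_add:
  assumes "fequiv X Y" "fequiv X' Y'"
  shows "fequiv (\<lambda>k. X k + X' k) (\<lambda>k. Y k + Y' k)"
proof -
  have "(\<lambda>k. fnorm (X k - Y k) + fnorm (X' k - Y' k)) \<longlonglongrightarrow> 0"
    using assms[THEN fequivD(3)] by (rule tendsto_add_zero)
  moreover have "fnorm ((X k + X' k) - (Y k + Y' k)) \<le> fnorm (X k - Y k) + fnorm (X' k - Y' k)"
    for k
    using fnorm_add[of "X k - Y k" "X' k - Y' k"] by (simp add: algebra_simps)
  ultimately have "(\<lambda>k. fnorm ((X k + X' k) - (Y k + Y' k))) \<longlonglongrightarrow> 0"
    by (rule null_le[OF _ fnorm_nonneg])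
  with fcauchy_add[OF assms[THEN fequivD(1)]] fcauchy_add[OF assms[THEN fequivD(2)]]
  show ?thesis unfolding fequiv_def by blast
qed

lemma fequiv_mult:
  assumes "fequiv X Y" "fequiv X' Y'"
  shows "fequiv (\<lambda>k. X k * X' k) (\<lambda>k. Y k * Y' k)"
proof -
  obtain A where A: "A > 0" "\<And>k. fnorm (X k) \<le> A"
    using fcauchy_bounded[OF fequivD(1)[OF assms(1)]] by blast
  obtain B where B: "B > 0" "\<And>k. fnorm (Y' k) \<le> B"
    using fcauchy_bounded[OF fequivD(2)[OF assms(2)]] by blast
  have lim: "(\<lambda>k. A * fnorm (X' k - Y' k) + fnorm (X k - Y k) * B) \<longlonglongrightarrow> 0"
    by (rule tendsto_add_zero[OF tendsto_mult_right_zero[OF fequivD(3)[OF assms(2)]]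
          tendsto_mult_left_zero[OF fequivD(3)[OF assms(1)]]])
  have bound: "fnorm (X k * X' k - Y k * Y' k)
      \<le> A * fnorm (X' k - Y' k) + fnorm (X k - Y k) * B" for k
  proof -
    have "fnorm (X k) * fnorm (X' k - Y' k) + fnorm (X k - Y k) * fnorm (Y' k)
        \<le> A * fnorm (X' k - Y' k) + fnorm (X k - Y k) * B"
      using A B by (intro add_mono mult_mono) (auto intro: less_imp_le)
    then show ?thesis by (rule order_trans[OF fnorm_mult_diff])
  qed
  have "(\<lambda>k. fnorm (X k * X' k - Y k * Y' k)) \<longlonglongrightarrow> 0"
  proof (rule null_le[OF lim])
    fix k
    show "0 \<le> fnorm (X k * X' k - Y k * Y' k)" by (rule fnorm_nonneg)
    show "fnorm (X k * X' k - Y k * Y' k) \<le> A * fnorm (X' k - Y' k) + fnorm (X k - Y k) * B"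
      by (rule bound)
  qed
  then show ?thesis
    unfolding fequiv_def
    by (intro conjI fcauchy_mult fequivD(1)[OF assms(1)] fequivD(1)[OF assms(2)]
        fequivD(2)[OF assms(1)] fequivD(2)[OF assms(2)])
qed

lemma fequiv_minus:
  assumes "fequiv X Y"
  shows "fequiv (\<lambda>k. - X k) (\<lambda>k. - Y k)"
  by (intro fequiv_lipschitz[OF assms, where C = "1"] fcauchy_minus fequivD[OF assms])
     (simp add: fnorm_diff_commute)

lemma fequiv_fscale:
  assumes "fequiv X Y"
  shows "fequiv (\<lambda>k. fscale c (X k)) (\<lambda>k. fscale c (Y k))"
  by (intro fequiv_lipschitz[OF assms, where C = "cmod c"] fcauchy_fscale fequivD[OF assms])
     (simp add: fnorm_scale flip: fscale_diff)

lemma fequiv_fstar: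
  assumes "fequiv X Y"
  shows "fequiv (\<lambda>k. fstar (X k)) (\<lambda>k. fstar (Y k))"
  by (intro fequiv_lipschitz[OF assms, where C = "1"] fcauchy_fstar fequivD[OF assms])
     (simp add: fnorm_star flip: fstar_diff)

lemma fequiv_lim:
  assumes "fequiv X Y"
  shows "lim (\<lambda>k. fnorm (X k)) = lim (\<lambda>k. fnorm (Y k))"
proof -
  have "(\<lambda>k. fnorm (X k) - fnorm (Y k)) \<longlonglongrightarrow> 0"
    using fequivD(3)[OF assms]
    by (rule Lim_null_comparison[rotated]) (simp add: fnorm_diff_triangle)
  moreover have "(\<lambda>k. fnorm (X k) - fnorm (Y k)) \<longlonglongrightarrow> lim (\<lambda>k. fnorm (X k)) - lim (\<lambda>k. fnorm (Y k))"
    by (intro tendsto_diff fcauchy_fnorm_LIMSEQ fequivD[OF assms])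
  ultimately show ?thesis using LIMSEQ_unique by fastforce
qed

instantiation cuntz :: (finite) "{real_normed_algebra, monoid_mult, scaleC}"
begin

lift_definition zero_cuntz :: "'a cuntz" is "\<lambda>_. 0"
  by (rule fequiv_refl[OF fcauchy_const])

lift_definition one_cuntz :: "'a cuntz" is "\<lambda>_. 1"
  by (rule fequiv_refl[OF fcauchy_const])

lift_definition plus_cuntz :: "'a cuntz \<Rightarrow> 'a cuntz \<Rightarrow> 'a cuntz" is "\<lambda>X Y k. X k + Y k"
  by (rule fequiv_add)

lift_definition uminus_cuntz :: "'a cuntz \<Rightarrow> 'a cuntz" is "\<lambda>X k. - X k"
  by (rule fequiv_minus)

definition minus_cuntz :: "'a cuntz \<Rightarrow> 'a cuntz \<Rightarrow> 'a cuntz" where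
  "minus_cuntz a b = a + - b"

lift_definition times_cuntz :: "'a cuntz \<Rightarrow> 'a cuntz \<Rightarrow> 'a cuntz" is "\<lambda>X Y k. X k * Y k"
  by (rule fequiv_mult)

lift_definition scaleC_cuntz :: "complex \<Rightarrow> 'a cuntz \<Rightarrow> 'a cuntz" is "\<lambda>c X k. fscale c (X k)"
  by (rule fequiv_fscale)

definition scaleR_cuntz :: "real \<Rightarrow> 'a cuntz \<Rightarrow> 'a cuntz" where
  "scaleR_cuntz r a = complex_of_real r *\<^sub>C a"

lift_definition norm_cuntz :: "'a cuntz \<Rightarrow> real" is "\<lambda>X. lim (\<lambda>k. fnorm (X k))"
  by (rule fequiv_lim)

definition dist_cuntz :: "'a cuntz \<Rightarrow> 'a cuntz \<Rightarrow> real" where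
  "dist_cuntz a b = norm (a - b)"

definition sgn_cuntz :: "'a cuntz \<Rightarrow> 'a cuntz" where
  "sgn_cuntz a = inverse (norm a) *\<^sub>R a"

definition uniformity_cuntz :: "('a cuntz \<times> 'a cuntz) filter" where
  "uniformity_cuntz = (INF e\<in>{0<..}. principal {(x, y). dist x y < e})"

definition open_cuntz :: "'a cuntz set \<Rightarrow> bool" where
  "open_cuntz U \<longleftrightarrow> (\<forall>x\<in>U. \<forall>\<^sub>F (x', y) in uniformity. x' = x \<longrightarrow> y \<in> U)"

instance
proof
  fix a b c :: "'a cuntz" and r t :: real
  note refl = fequiv_refl and I = fcauchy_add fcauchy_mult fcauchy_minus fcauchy_fscale fcauchy_const
  show "a + b + c = a + (b + c)"
    by transfer (auto simp: algebra_simps intro!: refl I dest: fequivD)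
  show "a + b = b + a"
    by transfer (auto simp: algebra_simps intro!: refl I dest: fequivD)
  show "0 + a = a"
    by transfer (auto intro!: refl dest: fequivD)
  show "- a + a = 0"
    by transfer (auto intro!: refl I)
  show "a - b = a + - b"
    by (rule minus_cuntz_def)
  show "a * b * c = a * (b * c)"
    by transfer (auto simp: mult.assoc intro!: refl I dest: fequivD)
  show "(a + b) * c = a * c + b * c"
    by transfer (auto simp: distrib_right intro!: refl I dest: fequivD)
  show "a * (b + c) = a * b + a * c"
    by transfer (auto simp: distrib_left intro!: refl I dest: fequivD)
  show "1 * a = a" "a * 1 = a"
    by (transfer; auto intro!: refl dest: fequivD)+
  show "r *\<^sub>R (a + b) = r *\<^sub>R a + r *\<^sub>R b"
    unfolding scaleR_cuntz_def
    by transfer (auto simp: fscale_add intro!: refl I dest: fequivD)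
  show "(r + t) *\<^sub>R a = r *\<^sub>R a + t *\<^sub>R a"
    unfolding scaleR_cuntz_def
    by transfer (auto simp: fscale_add_left intro!: refl I dest: fequivD)
  show "r *\<^sub>R t *\<^sub>R a = (r * t) *\<^sub>R a"
    unfolding scaleR_cuntz_def
    by transfer (auto simp: fscale_fscale intro!: refl I dest: fequivD)
  show "1 *\<^sub>R a = a"
    unfolding scaleR_cuntz_def
    by transfer (auto simp: fscale_one intro!: refl dest: fequivD)
  show "r *\<^sub>R a * b = r *\<^sub>R (a * b)"
    unfolding scaleR_cuntz_def
    by transfer (auto simp: fscale_mult_left intro!: refl I dest: fequivD)
  show "a * r *\<^sub>R b = r *\<^sub>R (a * b)"
    unfolding scaleR_cuntz_def
    by transfer (auto simp: fscale_mult_right intro!: refl I dest: fequivD)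
  show "dist a b = norm (a - b)"
    by (rule dist_cuntz_def)
  show "sgn a = inverse (norm a) *\<^sub>R a"
    by (rule sgn_cuntz_def)
  show "uniformity = (INF e\<in>{0<..}. principal {(x :: 'a cuntz, y). dist x y < e})"
    by (rule uniformity_cuntz_def)
  show "open U \<longleftrightarrow> (\<forall>x\<in>U. \<forall>\<^sub>F (x', y) in uniformity. x' = x \<longrightarrow> y \<in> U)" for U :: "'a cuntz set"
    by (rule open_cuntz_def)
  show "norm a = 0 \<longleftrightarrow> a = 0"
  proof (transfer)
    fix X :: "nat \<Rightarrow> 'a free" assume "fequiv X X"
    then have X: "fcauchy X" by (rule fequivD)
    have "lim (\<lambda>k. fnorm (X k)) = 0 \<longleftrightarrow> (\<lambda>k. fnorm (X k)) \<longlonglongrightarrow> 0"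
      using fcauchy_fnorm_LIMSEQ[OF X] limI by metis
    then show "lim (\<lambda>k. fnorm (X k)) = 0 \<longleftrightarrow> fequiv X (\<lambda>_. 0)"
      by (simp add: fequiv_def X fcauchy_const)
  qed
  show "norm (a + b) \<le> norm a + norm b"
  proof transfer
    fix X Y :: "nat \<Rightarrow> 'a free" assume "fequiv X X" "fequiv Y Y"
    then have XY: "fcauchy X" "fcauchy Y" by (auto dest: fequivD)
    show "lim (\<lambda>k. fnorm (X k + Y k)) \<le> lim (\<lambda>k. fnorm (X k)) + lim (\<lambda>k. fnorm (Y k))"
      by (rule LIMSEQ_le[OF fcauchy_fnorm_LIMSEQ[OF fcauchy_add[OF XY]]
            tendsto_add[OF XY[THEN fcauchy_fnorm_LIMSEQ]]])
         (auto intro: fnorm_add)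
  qed
  show "norm (a * b) \<le> norm a * norm b"
  proof transfer
    fix X Y :: "nat \<Rightarrow> 'a free" assume "fequiv X X" "fequiv Y Y"
    then have XY: "fcauchy X" "fcauchy Y" by (auto dest: fequivD)
    show "lim (\<lambda>k. fnorm (X k * Y k)) \<le> lim (\<lambda>k. fnorm (X k)) * lim (\<lambda>k. fnorm (Y k))"
      by (rule LIMSEQ_le[OF fcauchy_fnorm_LIMSEQ[OF fcauchy_mult[OF XY]]
            tendsto_mult[OF XY[THEN fcauchy_fnorm_LIMSEQ]]])
         (auto intro: fnorm_mult)
  qed
  show "norm (r *\<^sub>R a) = \<bar>r\<bar> * norm a"
    unfolding scaleR_cuntz_def
  proof (transfer fixing: r)
    fix X :: "nat \<Rightarrow> 'a free" assume "fequiv X X"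
    then have X: "fcauchy X" by (rule fequivD)
    show "lim (\<lambda>k. fnorm (fscale (complex_of_real r) (X k))) = \<bar>r\<bar> * lim (\<lambda>k. fnorm (X k))"
      by (simp add: fnorm_scale) (intro limI tendsto_mult_left fcauchy_fnorm_LIMSEQ X)
  qed
qed

end

definition cuntz_of :: "'n::finite free \<Rightarrow> 'n cuntz" where
  "cuntz_of a = abs_cuntz (\<lambda>_. a)"

lemma cuntz_of_transfer [transfer_rule]: "rel_fun (=) cr_cuntz (\<lambda>a _. a) cuntz_of"
  by (auto simp: rel_fun_def cr_cuntz_def cuntz_of_def intro: fequiv_refl fcauchy_const)

lemma cuntz_of_add: "cuntz_of (a + b) = cuntz_of a + cuntz_of b"
  by transfer (rule fequiv_refl[OF fcauchy_const])

lemma cuntz_of_minus: "cuntz_of (- a) = - cuntz_of a"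
  by transfer (rule fequiv_refl[OF fcauchy_const])

lemma cuntz_of_diff: "cuntz_of (a - b) = cuntz_of a - cuntz_of b"
  using cuntz_of_add[of a "- b"] by (simp add: cuntz_of_minus)

lemma cuntz_of_mult: "cuntz_of (a * b) = cuntz_of a * cuntz_of b"
  by transfer (rule fequiv_refl[OF fcauchy_const])

lemma cuntz_of_fscale: "cuntz_of (fscale c a) = c *\<^sub>C cuntz_of a"
  by transfer (rule fequiv_refl[OF fcauchy_const])

lemma cuntz_of_zero [simp]: "cuntz_of 0 = 0"
  by transfer (rule fequiv_refl[OF fcauchy_const])

lemma cuntz_of_one [simp]: "cuntz_of 1 = 1"
  by transfer (rule fequiv_refl[OF fcauchy_const])

lemma cuntz_of_sum: "cuntz_of (sum f A) = (\<Sum>i\<in>A. cuntz_of (f i))"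
  by (induction A rule: infinite_finite_induct) (auto simp: cuntz_of_add)

lemma norm_cuntz_of: "norm (cuntz_of a) = fnorm a"
  by transfer simp

lemma cuntz_of_approx:
  fixes x :: "'n::finite cuntz"
  assumes "e > 0"
  shows "\<exists>a. norm (x - cuntz_of a) < e"
proof -
  obtain X where "fequiv X X" and x: "x = abs_cuntz X"
    by (induct x) auto
  then have X: "fcauchy X" by (auto dest: fequivD)
  from fcauchyD[OF X, of "e/2"] assms
  obtain M where M: "\<And>k l. k \<ge> M \<Longrightarrow> l \<ge> M \<Longrightarrow> fnorm (X k - X l) < e/2" by auto
  have [transfer_rule]: "cr_cuntz X x"
    using X x by (simp add: cr_cuntz_def fequiv_refl)
  have "norm (x + cuntz_of (- X M)) = lim (\<lambda>k. fnorm (X k + - X M))"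
    by transfer simp
  also have "\<dots> \<le> e/2"
  proof (rule LIMSEQ_le_const2[OF fcauchy_fnorm_LIMSEQ[OF fcauchy_add[OF X fcauchy_const]]],
      intro exI allI impI)
    show "fnorm (X k + - X M) \<le> e/2" if "M \<le> k" for k
      using M[OF that, of M] by simp
  qed
  finally have "norm (x - cuntz_of (X M)) < e" using assms by (simp add: cuntz_of_minus)
  then show ?thesis by blast
qed

lemma closure_range_cuntz_of: "closure (range cuntz_of) = UNIV"
  by (auto simp: closure_approachable dist_norm norm_minus_commute[of "cuntz_of _"] cuntz_of_approx)

instantiation cuntz :: (finite) cstar_algebra
begin

lift_definition star_cuntz :: "'a cuntz \<Rightarrow> 'a cuntz" is "\<lambda>X k. fstar (X k)"
  by (rule fequiv_fstar)

instance
proof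
  fix a b :: "'a cuntz" and c d :: complex and r :: real
  note refl = fequiv_refl
    and I = fcauchy_add fcauchy_mult fcauchy_minus fcauchy_fscale fcauchy_fstar fcauchy_const
  show "c *\<^sub>C (a + b) = c *\<^sub>C a + c *\<^sub>C b"
    by transfer (auto simp: fscale_add intro!: refl I dest: fequivD)
  show "(c + d) *\<^sub>C a = c *\<^sub>C a + d *\<^sub>C a"
    by transfer (auto simp: fscale_add_left intro!: refl I dest: fequivD)
  show "c *\<^sub>C d *\<^sub>C a = (c * d) *\<^sub>C a"
    by transfer (auto simp: fscale_fscale intro!: refl I dest: fequivD)
  show "1 *\<^sub>C a = a"
    by transfer (auto simp: fscale_one intro!: refl dest: fequivD)
  show "r *\<^sub>R a = complex_of_real r *\<^sub>C a"
    by (rule scaleR_cuntz_def)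
  show "(c *\<^sub>C a) * b = c *\<^sub>C (a * b)"
    by transfer (auto simp: fscale_mult_left intro!: refl I dest: fequivD)
  show "a * (c *\<^sub>C b) = c *\<^sub>C (a * b)"
    by transfer (auto simp: fscale_mult_right intro!: refl I dest: fequivD)
  show "star (star a) = a"
    by transfer (auto intro!: refl dest: fequivD)
  show "star (a + b) = star a + star b"
    by transfer (auto simp: fstar_add intro!: refl I dest: fequivD)
  show "star (a * b) = star b * star a"
    by transfer (auto simp: fstar_mult intro!: refl I dest: fequivD)
  show "star (c *\<^sub>C a) = cnj c *\<^sub>C star a"
    by transfer (auto simp: fstar_fscale intro!: refl I dest: fequivD)
  show "norm (c *\<^sub>C a) = cmod c * norm a"
  proof (transfer fixing: c)
    fix X :: "nat \<Rightarrow> 'a free" assume "fequiv X X"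
    then have X: "fcauchy X" by (rule fequivD)
    show "lim (\<lambda>k. fnorm (fscale c (X k))) = cmod c * lim (\<lambda>k. fnorm (X k))"
      by (simp add: fnorm_scale) (intro limI tendsto_mult_left fcauchy_fnorm_LIMSEQ X)
  qed
  show "norm (star a * a) = (norm a)\<^sup>2"
  proof transfer
    fix X :: "nat \<Rightarrow> 'a free" assume "fequiv X X"
    then have X: "fcauchy X" by (rule fequivD)
    show "lim (\<lambda>k. fnorm (fstar (X k) * X k)) = (lim (\<lambda>k. fnorm (X k)))\<^sup>2"
      by (simp add: fnorm_cstar) (intro limI tendsto_power fcauchy_fnorm_LIMSEQ X)
  qed
next
  fix x :: "nat \<Rightarrow> 'a cuntz"
  assume x: "Cauchy x"
  have "\<exists>a. norm (x k - cuntz_of a) < inverse (of_nat (Suc k))" for k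
    by (rule cuntz_of_approx) simp
  then obtain A where A: "\<And>k. norm (x k - cuntz_of (A k)) < inverse (of_nat (Suc k))"
    by metis
  have "(\<lambda>k. norm (x k - cuntz_of (A k))) \<longlonglongrightarrow> 0"
    by (rule null_le[OF LIMSEQ_inverse_real_of_nat]) (use A in \<open>auto intro: less_imp_le\<close>)
  then have near: "(\<lambda>k. x k - cuntz_of (A k)) \<longlonglongrightarrow> 0"
    by (simp add: tendsto_norm_zero_iff)
  have "Cauchy (\<lambda>k. cuntz_of (A k))"
    using Cauchy_diff[OF x LIMSEQ_imp_Cauchy[OF near]] by simp
  then have CA: "fcauchy A"
    unfolding Cauchy_def fcauchy_def dist_norm
    by (simp flip: cuntz_of_diff add: norm_cuntz_of)
  define L where "L = abs_cuntz A"
  have [transfer_rule]: "cr_cuntz A L"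
    using CA by (simp add: L_def cr_cuntz_def fequiv_refl)
  have "(\<lambda>k. norm (cuntz_of (A k) - L)) \<longlonglongrightarrow> 0"
  proof (rule LIMSEQ_I)
    fix e :: real assume "e > 0"
    with fcauchyD[OF CA, of "e/2"]
    obtain M where M: "\<And>k l. k \<ge> M \<Longrightarrow> l \<ge> M \<Longrightarrow> fnorm (A k - A l) < e/2" by auto
    have "norm (cuntz_of (A l) + - L) < e" if "l \<ge> M" for l
    proof -
      have "norm (cuntz_of (A l) + - L) = lim (\<lambda>k. fnorm (A l + - A k))"
        by transfer simp
      also have "\<dots> \<le> e/2"
      proof (rule LIMSEQ_le_const2[OF fcauchy_fnorm_LIMSEQ[OF fcauchy_add[OF fcauchy_const
              fcauchy_minus[OF CA]]]], intro exI allI impI)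
        show "fnorm (A l + - A k) \<le> e/2" if "M \<le> k" for k
          using M[OF \<open>l \<ge> M\<close> that] by simp
      qed
      finally show ?thesis using \<open>e > 0\<close> by simp
    qed
    then show "\<exists>M. \<forall>l\<ge>M. norm (norm (cuntz_of (A l) - L) - 0) < e" by auto
  qed
  then have "(\<lambda>k. cuntz_of (A k) - L) \<longlonglongrightarrow> 0"
    by (simp add: tendsto_norm_zero_iff)
  from tendsto_add[OF tendsto_add[OF near this] tendsto_const[of L]]
  have "x \<longlonglongrightarrow> L" by simp
  then show "convergent x" by (rule convergentI)
qed

end

lemma cuntz_of_fstar: "cuntz_of (fstar a) = star (cuntz_of a)"
  by transfer (rule fequiv_refl[OF fcauchy_const])

definition cuntz_gen :: "'n::finite \<Rightarrow> 'n cuntz" where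
  "cuntz_gen i = cuntz_of (fgen i)"

lemma cuntz_isometry: "star (cuntz_gen i) * cuntz_gen j = (if i = j then 1 else 0)"
proof -
  have "norm (cuntz_of (fstar (fgen i) * fgen j - (if i = j then 1 else 0))) = 0"
    unfolding norm_cuntz_of by (rule fnorm_rel1)
  then show ?thesis
    by (cases "i = j") (simp_all add: cuntz_gen_def cuntz_of_diff cuntz_of_mult cuntz_of_fstar)
qed

lemma cuntz_sum: "(\<Sum>i\<in>UNIV. cuntz_gen i * star (cuntz_gen i)) = 1"
proof -
  have "norm (cuntz_of ((\<Sum>i\<in>UNIV. fgen i * fstar (fgen i)) - (1 :: 'n::finite free))) = 0"
    unfolding norm_cuntz_of by (rule fnorm_rel2)
  then show ?thesis
    by (simp add: cuntz_gen_def cuntz_of_diff cuntz_of_sum cuntz_of_mult cuntz_of_fstar)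
qed

lemma scaleC_zero_right: "c *\<^sub>C (0::'a::complex_vector) = 0"
  using scaleC_add_right[of c 0 "0::'a"] by simp

lemma scaleC_zero_left: "0 *\<^sub>C (x::'a::complex_vector) = 0"
  using scaleC_add_left[of 0 0 x] by simp

lemma star_zero: "star (0::'a::cstar_algebra) = 0"
  using star_add[of 0 "0::'a"] by simp

lemma star_one: "star (1::'a::cstar_algebra) = 1"
  by (metis mult.right_neutral mult.left_neutral star_mult star_star)

lemma star_diff: "star (a - b) = star a - star (b::'a::cstar_algebra)"
  using star_add[of "a - b" b] by (simp add: eq_diff_eq)

lemma norm_star: "norm (star a) = norm (a::'a::cstar_algebra)"
proof -
  have le: "norm b \<le> norm (star b)" for b :: 'a
  proof (cases "norm b = 0")
    case False
    have "norm b * norm b \<le> norm (star b) * norm b"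
      using cstar_identity[of b] norm_mult_ineq[of "star b" b] by (simp add: power2_eq_square)
    with False show ?thesis by simp
  qed simp
  from le[of a] le[of "star a"] show ?thesis by (simp add: star_star)
qed

definition star_hom :: "('a::cstar_algebra \<Rightarrow> 'b::cstar_algebra) \<Rightarrow> bool" where
  "star_hom \<phi> \<longleftrightarrow>
     (\<forall>a b. \<phi> (a + b) = \<phi> a + \<phi> b) \<and>
     (\<forall>c a. \<phi> (c *\<^sub>C a) = c *\<^sub>C \<phi> a) \<and>
     (\<forall>a b. \<phi> (a * b) = \<phi> a * \<phi> b) \<and>
     \<phi> 1 = 1 \<and>
     (\<forall>a. \<phi> (star a) = star (\<phi> a))"

fun eval_letter :: "('n \<Rightarrow> 'b::cstar_algebra) \<Rightarrow> 'n letter \<Rightarrow> 'b" where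
  "eval_letter t (Gen i) = t i"
| "eval_letter t (GenStar i) = star (t i)"

fun eval_word :: "('n \<Rightarrow> 'b::cstar_algebra) \<Rightarrow> 'n word \<Rightarrow> 'b" where
  "eval_word t (Word u) = prod_list (map (eval_letter t) u)"

definition eval_free :: "('n \<Rightarrow> 'b::cstar_algebra) \<Rightarrow> 'n free \<Rightarrow> 'b" where
  "eval_free t a = (\<Sum>w\<in>Poly_Mapping.keys a. Poly_Mapping.lookup a w *\<^sub>C eval_word t w)"

lemma prod_list_append_monoid: "prod_list (u @ v) = prod_list u * (prod_list v :: 'a::monoid_mult)"
  by (induction u) (simp_all add: mult.assoc)

lemma eval_word_add: "eval_word t (v + w) = eval_word t v * eval_word t w"
  by (cases v; cases w) (simp add: prod_list_append_monoid)

lemma eval_word_star: "eval_word t (word_star w) = star (eval_word t w)"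
proof (cases w)
  case (Word u)
  have "eval_letter t (letter_star l) = star (eval_letter t l)" for l
    by (cases l) (simp_all add: star_star)
  then have "prod_list (map (eval_letter t) (rev (map letter_star u)))
      = star (prod_list (map (eval_letter t) u))"
    by (induction u) (simp_all add: star_one star_mult prod_list_append_monoid)
  with Word show ?thesis by simp
qed

lemma eval_free_single: "eval_free t (Poly_Mapping.single w c) = c *\<^sub>C eval_word t w"
  by (cases "c = 0") (simp_all add: eval_free_def scaleC_zero_left)

lemma eval_free_zero: "eval_free t 0 = 0"
  by (simp add: eval_free_def)

lemma eval_free_add: "eval_free t (a + b) = eval_free t a + eval_free t b"
  unfolding eval_free_def
  by (rule setsum_keys_plus_distrib) (simp_all add: scaleC_zero_left scaleC_add_left)

lemma eval_free_minus: "eval_free t (- a) = - eval_free t a"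
  using eval_free_add[of t "- a" a] by (simp add: eval_free_zero eq_neg_iff_add_eq_0)

lemma eval_free_diff: "eval_free t (a - b) = eval_free t a - eval_free t b"
  using eval_free_add[of t a "- b"] by (simp add: eval_free_minus)

lemma eval_free_sum: "eval_free t (sum f A) = (\<Sum>i\<in>A. eval_free t (f i))"
  by (induction A rule: infinite_finite_induct) (auto simp: eval_free_add eval_free_zero)

lemma eval_free_mult: "eval_free t (a * b) = eval_free t a * eval_free t b"
proof (induction a rule: free_induct)
  case (single v c)
  show ?case
  proof (induction b rule: free_induct)
    case (single w d)
    show ?case
      by (simp add: mult_single eval_free_single eval_word_add scaleC_mult_left scaleC_mult_right
          scaleC_scaleC mult.commute)
  qed (simp_all add: eval_free_add eval_free_zero distrib_left)
qed (simp_all add: eval_free_add eval_free_zero distrib_right)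

lemma eval_word_zero: "eval_word t 0 = 1"
  by (simp add: zero_word_def)

lemma eval_free_one: "eval_free t 1 = 1"
  using eval_free_single[of t 0 1] by (simp add: eval_word_zero scaleC_one)

lemma eval_free_fscale: "eval_free t (fscale c a) = c *\<^sub>C eval_free t a"
  by (simp add: fscale_def eval_free_mult eval_free_single eval_word_zero scaleC_mult_left)

lemma eval_free_fstar: "eval_free t (fstar a) = star (eval_free t a)"
  by (induction a rule: free_induct)
     (simp_all add: fstar_add fstar_single eval_free_add eval_free_single eval_word_star
        eval_free_zero star_zero star_add star_scaleC)

lemma eval_free_fgen: "eval_free t (fgen i) = t i"
  by (simp add: fgen_def eval_free_single scaleC_one)

lemma eval_free_norm_le:
  fixes t :: "'n::finite \<Rightarrow> 'b::cstar_algebra"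
  assumes "\<And>i j. star (t i) * t j = (if i = j then 1 else 0)"
    and "(\<Sum>i\<in>UNIV. t i * star (t i)) = 1"
  shows "norm (eval_free t a) \<le> fnorm a"
proof (rule fnorm_upper)
  show "cuntz_seminorm (\<lambda>a. norm (eval_free t a))"
    unfolding cuntz_seminorm_def
    by (auto simp: eval_free_add eval_free_fscale eval_free_mult eval_free_fstar eval_free_diff
        eval_free_sum eval_free_one eval_free_zero eval_free_fgen assms norm_scaleC cstar_identity
        norm_triangle_ineq norm_mult_ineq)
qed

lemma star_hom_eval_free:
  assumes "star_hom \<phi>" and "\<And>i. \<phi> (cuntz_gen i) = t i"
  shows "\<phi> (cuntz_of a) = eval_free t a"
proof -
  note hom = assms(1)[unfolded star_hom_def, rule_format]
  have zero: "\<phi> 0 = 0" using assms(1) unfolding star_hom_def by (metis add_cancel_left_left)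
  have word: "\<phi> (cuntz_of (Poly_Mapping.single (Word u) 1)) = eval_word t (Word u)" for u
  proof (induction u)
    case Nil
    then show ?case using assms(1) by (simp flip: zero_word_def add: star_hom_def)
        (simp add: zero_word_def)
  next
    case (Cons l u)
    have "Poly_Mapping.single (Word (l # u)) 1
        = Poly_Mapping.single (Word [l]) 1 * Poly_Mapping.single (Word u) (1::complex)"
      by (simp add: mult_single)
    moreover have "\<phi> (cuntz_of (Poly_Mapping.single (Word [l]) 1)) = eval_letter t l"
    proof (cases l)
      case (Gen i)
      then show ?thesis using assms(2)[of i] by (simp add: cuntz_gen_def fgen_def)
    next
      case (GenStar i)
      then have "Poly_Mapping.single (Word [l]) 1 = fstar (fgen i)"
        by (simp add: fgen_def fstar_single)
      with GenStar show ?thesis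
        using assms(1) assms(2)[of i] by (simp add: cuntz_gen_def cuntz_of_fstar star_hom_def)
    qed
    ultimately show ?case using Cons assms(1) by (simp add: cuntz_of_mult star_hom_def)
  qed
  show ?thesis
  proof (induction a rule: free_induct)
    case (single w c)
    obtain u where w: "w = Word u" by (cases w)
    have "Poly_Mapping.single w c = fscale c (Poly_Mapping.single w 1)"
      by (simp add: fscale_single)
    then show ?case
      using assms(1) word[of u] by (simp add: w cuntz_of_fscale eval_free_fscale eval_free_single
          scaleC_one star_hom_def del: eval_word.simps)
  next
    case (add a b)
    then show ?case using assms(1) by (simp add: cuntz_of_add eval_free_add star_hom_def)
  qed (simp add: zero eval_free_zero)
qed

lemma cuntz_of_dense_sequence:
  fixes x :: "'n::finite cuntz"
  obtains A where "(\<lambda>k. cuntz_of (A k)) \<longlonglongrightarrow> x"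
proof -
  have "x \<in> closure (range cuntz_of)" by (simp add: closure_range_cuntz_of)
  then obtain X where X: "\<And>k. X k \<in> range cuntz_of" "X \<longlonglongrightarrow> x"
    unfolding closure_sequential by blast
  from X(1) have "\<forall>k. \<exists>a. X k = cuntz_of a" by blast
  then obtain A where "\<And>k. X k = cuntz_of (A k)" by metis
  with X(2) that[of A] show thesis by (metis (no_types, lifting) ext)
qed

text \<open>Universal property.  Boundedness is automatic for *-homomorphisms of C*-algebras; it is
  stated because automatic continuity is not proved here.\<close>

theorem cuntz_universal:
  fixes t :: "'n::finite \<Rightarrow> 'b::cstar_algebra"
  assumes "\<And>i j. star (t i) * t j = (if i = j then 1 else 0)"
    and "(\<Sum>i\<in>UNIV. t i * star (t i)) = 1"
  shows "\<exists>!\<phi>. star_hom \<phi> \<and> bounded_linear \<phi> \<and> (\<forall>i. \<phi> (cuntz_gen i) = t i)"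
proof (rule ex_ex1I)
  note le = eval_free_norm_le[OF assms]
  define \<phi> where "\<phi> x = lim (\<lambda>k. eval_free t ((SOME A. (\<lambda>k. cuntz_of (A k)) \<longlonglongrightarrow> x) k))"
    for x :: "'n cuntz"
  have \<phi>: "(\<lambda>k. eval_free t (A k)) \<longlonglongrightarrow> \<phi> x" if A: "(\<lambda>k. cuntz_of (A k)) \<longlonglongrightarrow> x" for A x
  proof -
    define B where "B = (SOME A. (\<lambda>k. cuntz_of (A k)) \<longlonglongrightarrow> x)"
    have B: "(\<lambda>k. cuntz_of (B k)) \<longlonglongrightarrow> x"
      unfolding B_def by (rule someI[of "\<lambda>A. (\<lambda>k. cuntz_of (A k)) \<longlonglongrightarrow> x", OF A])
    have "Cauchy (\<lambda>k. eval_free t (B k))"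
    proof (rule CauchyI)
      fix e :: real assume "e > 0"
      from CauchyD[OF LIMSEQ_imp_Cauchy[OF B] this] obtain M
        where M: "\<And>k l. k \<ge> M \<Longrightarrow> l \<ge> M \<Longrightarrow> norm (cuntz_of (B k) - cuntz_of (B l)) < e" by blast
      have "norm (eval_free t (B k) - eval_free t (B l)) < e" if "k \<ge> M" "l \<ge> M" for k l
        using M[OF that] le[of "B k - B l"]
        by (simp add: eval_free_diff norm_cuntz_of flip: cuntz_of_diff)
      then show "\<exists>M. \<forall>k\<ge>M. \<forall>l\<ge>M. norm (eval_free t (B k) - eval_free t (B l)) < e" by blast
    qed
    then have 1: "(\<lambda>k. eval_free t (B k)) \<longlonglongrightarrow> \<phi> x"
      unfolding \<phi>_def B_def[symmetric]
      by (simp add: Cauchy_convergent_iff convergent_LIMSEQ_iff)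
    have "(\<lambda>k. norm (cuntz_of (A k) - cuntz_of (B k))) \<longlonglongrightarrow> 0"
      using tendsto_diff[OF A B] by (simp add: tendsto_norm_zero_iff)
    then have "(\<lambda>k. norm (eval_free t (A k) - eval_free t (B k))) \<longlonglongrightarrow> 0"
    proof (rule null_le)
      fix k
      show "norm (eval_free t (A k) - eval_free t (B k)) \<le> norm (cuntz_of (A k) - cuntz_of (B k))"
        using le[of "A k - B k"] by (simp add: eval_free_diff norm_cuntz_of flip: cuntz_of_diff)
    qed simp
    then have "(\<lambda>k. eval_free t (A k) - eval_free t (B k)) \<longlonglongrightarrow> 0"
      by (simp add: tendsto_norm_zero_iff)
    from tendsto_add[OF this 1] show ?thesis by simp
  qed
  have of: "\<phi> (cuntz_of a) = eval_free t a" for a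
    using \<phi>[of "\<lambda>_. a" "cuntz_of a"] LIMSEQ_unique tendsto_const by blast
  have add: "\<phi> (x + y) = \<phi> x + \<phi> y" for x y
  proof -
    obtain A B where A: "(\<lambda>k. cuntz_of (A k)) \<longlonglongrightarrow> x" and B: "(\<lambda>k. cuntz_of (B k)) \<longlonglongrightarrow> y"
      using cuntz_of_dense_sequence by metis
    have "(\<lambda>k. eval_free t (A k + B k)) \<longlonglongrightarrow> \<phi> (x + y)"
      using tendsto_add[OF A B] by (intro \<phi>) (simp add: cuntz_of_add)
    then show ?thesis
      using tendsto_add[OF \<phi>[OF A] \<phi>[OF B]] LIMSEQ_unique by (simp add: eval_free_add) blast
  qed
  have mult: "\<phi> (x * y) = \<phi> x * \<phi> y" for x y
  proof -
    obtain A B where A: "(\<lambda>k. cuntz_of (A k)) \<longlonglongrightarrow> x" and B: "(\<lambda>k. cuntz_of (B k)) \<longlonglongrightarrow> y"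
      using cuntz_of_dense_sequence by metis
    have "(\<lambda>k. eval_free t (A k * B k)) \<longlonglongrightarrow> \<phi> (x * y)"
      using tendsto_mult[OF A B] by (intro \<phi>) (simp add: cuntz_of_mult)
    then show ?thesis
      using tendsto_mult[OF \<phi>[OF A] \<phi>[OF B]] LIMSEQ_unique by (simp add: eval_free_mult) blast
  qed
  have lim_scaleC: "(\<lambda>k. c *\<^sub>C X k) \<longlonglongrightarrow> c *\<^sub>C x" if "X \<longlonglongrightarrow> x"
    for c and X :: "nat \<Rightarrow> 'c::cstar_algebra" and x
    using tendsto_mult[OF tendsto_const[of "c *\<^sub>C (1::'c)"] that] by (simp add: scaleC_mult_left)
  have lim_star: "(\<lambda>k. star (X k)) \<longlonglongrightarrow> star x" if "X \<longlonglongrightarrow> x"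
    for X :: "nat \<Rightarrow> 'c::cstar_algebra" and x
    using that by (simp add: LIMSEQ_iff norm_star flip: star_diff)
  have scaleC: "\<phi> (c *\<^sub>C x) = c *\<^sub>C \<phi> x" for c x
  proof -
    obtain A where A: "(\<lambda>k. cuntz_of (A k)) \<longlonglongrightarrow> x"
      using cuntz_of_dense_sequence by metis
    have "(\<lambda>k. eval_free t (fscale c (A k))) \<longlonglongrightarrow> \<phi> (c *\<^sub>C x)"
      using lim_scaleC[OF A] by (intro \<phi>) (simp add: cuntz_of_fscale)
    then show ?thesis
      using lim_scaleC[OF \<phi>[OF A]] LIMSEQ_unique by (simp add: eval_free_fscale) blast
  qed
  have star: "\<phi> (star x) = star (\<phi> x)" for x
  proof -
    obtain A where A: "(\<lambda>k. cuntz_of (A k)) \<longlonglongrightarrow> x"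
      using cuntz_of_dense_sequence by metis
    have "(\<lambda>k. eval_free t (fstar (A k))) \<longlonglongrightarrow> \<phi> (star x)"
      using lim_star[OF A] by (intro \<phi>) (simp add: cuntz_of_fstar)
    then show ?thesis
      using lim_star[OF \<phi>[OF A]] LIMSEQ_unique by (simp add: eval_free_fstar) blast
  qed
  have norm: "norm (\<phi> x) \<le> norm x" for x
  proof -
    obtain A where A: "(\<lambda>k. cuntz_of (A k)) \<longlonglongrightarrow> x"
      using cuntz_of_dense_sequence by metis
    show ?thesis
      by (rule LIMSEQ_le[OF tendsto_norm[OF \<phi>[OF A]] tendsto_norm[OF A]])
         (simp add: norm_cuntz_of le)
  qed
  have "star_hom \<phi>"
    unfolding star_hom_def using add mult scaleC star of[of 1] by (simp add: eval_free_one)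
  moreover have "bounded_linear \<phi>"
    by (rule bounded_linear_intro[where K = 1]) (simp_all add: add scaleC scaleR_scaleC norm)
  moreover have "\<phi> (cuntz_gen i) = t i" for i
    by (simp add: cuntz_gen_def of eval_free_fgen)
  ultimately show "\<exists>\<phi>. star_hom \<phi> \<and> bounded_linear \<phi> \<and> (\<forall>i. \<phi> (cuntz_gen i) = t i)" by blast
next
  fix \<phi> \<psi> :: "'n cuntz \<Rightarrow> 'b"
  assume \<phi>: "star_hom \<phi> \<and> bounded_linear \<phi> \<and> (\<forall>i. \<phi> (cuntz_gen i) = t i)"
    and \<psi>: "star_hom \<psi> \<and> bounded_linear \<psi> \<and> (\<forall>i. \<psi> (cuntz_gen i) = t i)"
  show "\<phi> = \<psi>"
  proof
    fix x
    obtain A :: "nat \<Rightarrow> 'n free" where A: "(\<lambda>k. cuntz_of (A k)) \<longlonglongrightarrow> x"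
      using cuntz_of_dense_sequence by metis
    have "(\<lambda>k. eval_free t (A k)) \<longlonglongrightarrow> \<phi> x" "(\<lambda>k. eval_free t (A k)) \<longlonglongrightarrow> \<psi> x"
      using bounded_linear.tendsto[of \<phi>, OF _ A] bounded_linear.tendsto[of \<psi>, OF _ A] \<phi> \<psi>
      by (simp_all add: star_hom_eval_free)
    then show "\<phi> x = \<psi> x" by (rule LIMSEQ_unique)
  qed
qed

section \<open>Tensors and sub-Cuntz states\<close>

text \<open>A vector \<open>\<Sum> z\<^sub>J e\<^sub>J\<close> is the family of its coefficients, indexed by all finite words \<open>J\<close> over
  the index set \<open>'n\<close> (in place of \<open>{1..n}\<close>); degree \<open>m\<close> means support in words of length \<open>m\<close>.\<close>

definition tensor_space :: "nat \<Rightarrow> ('n::finite list \<Rightarrow> complex) set" where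
  "tensor_space m = {z. \<forall>J. length J \<noteq> m \<longrightarrow> z J = 0}"

definition unit_vectors :: "nat \<Rightarrow> ('n::finite list \<Rightarrow> complex) set" where
  "unit_vectors m = {z \<in> tensor_space m. (\<Sum>J | length J = m. (cmod (z J))\<^sup>2) = 1}"

text \<open>The product of the tensor algebra; see \<open>tensor_homogeneous\<close> for vectors with a degree.\<close>

definition tensor ::
  "('n list \<Rightarrow> complex) \<Rightarrow> ('n list \<Rightarrow> complex) \<Rightarrow> 'n list \<Rightarrow> complex"  (infixr \<open>\<otimes>\<^sub>v\<close> 70) where
  "(x \<otimes>\<^sub>v y) K = (\<Sum>i\<le>length K. x (take i K) * y (drop i K))"

lemma tensor_homogeneous:
  assumes "x \<in> tensor_space m" "y \<in> tensor_space l"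
  shows "x \<otimes>\<^sub>v y \<in> tensor_space (m + l)"
    and "length J = m \<Longrightarrow> length L = l \<Longrightarrow> (x \<otimes>\<^sub>v y) (J @ L) = x J * y L"
proof -
  have zero: "x (take i K) * y (drop i K) = 0"
    if "i \<le> length K" "\<not> (i = m \<and> length K = m + l)" for i K
  proof (cases "i = m")
    case True
    with that have "length (drop i K) \<noteq> l" by auto
    with assms show ?thesis by (simp add: tensor_space_def)
  next
    case False
    with that have "length (take i K) \<noteq> m" by simp
    with assms show ?thesis by (simp add: tensor_space_def)
  qed
  show "x \<otimes>\<^sub>v y \<in> tensor_space (m + l)"
    by (auto simp: tensor_space_def tensor_def intro!: sum.neutral zero)
  assume J: "length J = m" "length L = l"
  have "(x \<otimes>\<^sub>v y) (J @ L) = (\<Sum>i\<in>{m}. x (take i (J @ L)) * y (drop i (J @ L)))"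
    unfolding tensor_def
  proof (rule sum.mono_neutral_right)
    show "\<forall>i\<in>{..length (J @ L)} - {m}. x (take i (J @ L)) * y (drop i (J @ L)) = 0"
      by (intro ballI zero) auto
  qed (use J in auto)
  with J show "(x \<otimes>\<^sub>v y) (J @ L) = x J * y L" by simp
qed

primrec tensor_power :: "('n list \<Rightarrow> complex) \<Rightarrow> nat \<Rightarrow> 'n list \<Rightarrow> complex" where
  "tensor_power x 0 = (\<lambda>J. if J = [] then 1 else 0)"
| "tensor_power x (Suc p) = x \<otimes>\<^sub>v tensor_power x p"

definition nonperiodic :: "('n::finite list \<Rightarrow> complex) \<Rightarrow> bool" where
  "nonperiodic z \<longleftrightarrow>
     (\<forall>p\<ge>1. \<forall>x \<in> (\<Union>k\<in>{1..}. tensor_space k). z = tensor_power x p \<longrightarrow> p = 1)"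

definition cuntz_word :: "'n::finite list \<Rightarrow> 'n cuntz" where
  "cuntz_word J = prod_list (map cuntz_gen J)"

definition sub_cuntz_state :: "('n::finite list \<Rightarrow> complex) \<Rightarrow> ('n cuntz \<Rightarrow> complex) \<Rightarrow> bool" where
  "sub_cuntz_state z \<omega> \<longleftrightarrow>
     is_state \<omega> \<and>
     (\<exists>m\<ge>1. z \<in> unit_vectors m \<and> (\<forall>J. length J = m \<longrightarrow> \<omega> (cuntz_word J) = cnj (z J)))"

end

theory Submission
  imports Defs
begin

text \<open>
For a tensor \<open>z\<close> of degree \<open>m\<close> let \<open>s(z) = \<Sum> z\<^sub>J s\<^sub>J\<close>, the sum over the words \<open>J\<close> of length \<open>m\<close>; it is
  an isometry when \<open>z\<close> is a unit vector, and \<open>s(x) s(y) = s(x \<otimes> y)\<close>.  A state \<open>\<omega>\<close> with cyclic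
  vector \<open>\<Omega>\<close> is a sub-Cuntz state by \<open>z\<close> exactly when \<open>s(z) \<Omega> = \<Omega>\<close>, because \<open>\<omega>(s(z)) = 1\<close> is the
  equality case of the Cauchy-Schwarz inequality (\<open>sub_cuntz_state_fixed\<close>).  The theorem thus
  concerns fixed vectors of such isometries, and these are studied through the correlations
  \<open>v(J) = \<langle>s\<^sub>J \<Omega>, \<Psi>\<rangle>\<close> of two fixed vectors \<open>s(z) \<Omega> = \<Omega>\<close> and \<open>s(y) \<Psi> = \<Psi>\<close> in one representation.

  Let \<open>v\<^sub>k\<close> be the part of \<open>v\<close> of degree \<open>k\<close>.  Moving \<open>s\<^sub>K\<close> to the other side gives
  \<open>v\<^sub>k\<^sub>+\<^sub>l = y \<otimes> v\<^sub>k\<close>, where \<open>l\<close> is the degree of \<open>y\<close>, so \<open>\<parallel>v\<^sub>k\<parallel>\<close> is periodic in \<open>k\<close> with period \<open>l\<close>.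
  Inserting \<open>\<Omega> = s(z) \<Omega>\<close> shows that \<open>v\<^sub>k\<close> is the contraction of \<open>v\<^sub>k\<^sub>+\<^sub>m\<close> with \<open>z\<close> from the right, so
  \<open>\<parallel>v\<^sub>k\<parallel> \<le> \<parallel>v\<^sub>k\<^sub>+\<^sub>m\<parallel>\<close>.  Both together force equality, hence \<open>v\<^sub>k\<^sub>+\<^sub>m = v\<^sub>k \<otimes> z\<close>
  (\<open>degree_part_tensor_right\<close>).  From here on only the combinatorics of the tensor algebra, a free
  algebra, is needed: \<open>a \<otimes> b = c \<otimes> d\<close> with \<open>a\<close> of degree at most that of \<open>c\<close> makes \<open>a\<close> a left factor of
  \<open>c\<close> (\<open>tensor_levi\<close>), and tensors that commute up to a scalar are, up to scalars, powers of one
  tensor (\<open>tensor_quasi_commuting_common_root\<close>).  Over the complex numbers the scalar can be absorbed into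
  the root, so a nonperiodic \<open>z\<close> commutes with no nonzero tensor of smaller positive degree.

  Uniqueness of the state, used for (ii) \<open>\<Longrightarrow>\<close> (i).  For \<open>y = z\<close> and \<open>\<Psi> = \<Omega>\<close> the relations say that
  \<open>z\<close> commutes with every \<open>v\<^sub>k\<close>; thus \<open>v\<^sub>k = 0\<close> for \<open>0 < k < m\<close>, and the recursion in \<open>z\<close> determines all
  values of the state on words.  These determine it everywhere: modulo the left ideal generated by
  \<open>s(z) - 1\<close>, which annihilates \<open>\<Omega>\<close>, every element of the dense *-subalgebra is a combination of words
  without adjoints (\<open>reducible_by_cuntz_lin\<close>), and vector functionals of representations are continuous
  (\<open>rep_contractive\<close>).  If \<open>z = x\<^sub>1 \<otimes> x\<^sub>2\<close> and \<open>y = x\<^sub>2 \<otimes> x\<^sub>1\<close>, then \<open>\<Psi> = s(x\<^sub>2) \<Omega>\<close> is a unit vector fixed by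
  \<open>s(y)\<close>, and it is cyclic since \<open>s(x\<^sub>1) \<Psi> = \<Omega>\<close>.  By uniqueness it implements the state of \<open>y\<close>, and cyclic
  representations with equal vector states are equivalent.

  (i) \<open>\<Longrightarrow>\<close> (ii).  An equivalence puts both cyclic vectors into one representation.  By cyclicity some
  \<open>v\<^sub>k\<close> is nonzero; take \<open>k\<close> least, so \<open>k < l\<close>, and put \<open>x = v\<^sub>k\<close>.  Then \<open>y\<^sup>m \<otimes> x = x \<otimes> z\<^sup>l\<close>, hence
  \<open>y = x \<otimes> u\<close> for some \<open>u\<close>, and \<open>(u \<otimes> x)\<^sup>m = z\<^sup>l\<close>.  So \<open>u \<otimes> x\<close>, of degree \<open>l\<close>, commutes with a power of the
  nonperiodic \<open>z\<close>, which forces \<open>m\<close> to divide \<open>l\<close> (\<open>tensor_commute_with_power_degree_dvd\<close>).  By symmetry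
  \<open>l\<close> divides \<open>m\<close>.  Now \<open>l = m\<close> and \<open>y \<otimes> x = v\<^sub>k\<^sub>+\<^sub>m = x \<otimes> z\<close>, so \<open>z = u \<otimes> x\<close>; the case \<open>k = 0\<close> gives \<open>z = y\<close>, and
  otherwise \<open>u\<close> and \<open>x\<close> can be rescaled to unit vectors.
\<close>

section \<open>Homogeneous tensors as a free algebra\<close>

lemma tensor_apply_left:
  assumes "x \<in> tensor_space m"
  shows "(x \<otimes>\<^sub>v y) K = (if m \<le> length K then x (take m K) * y (drop m K) else 0)"
proof -
  have "(x \<otimes>\<^sub>v y) K = (\<Sum>i\<le>length K. if i = m then x (take i K) * y (drop i K) else 0)"
    unfolding tensor_def using assms by (intro sum.cong) (auto simp: tensor_space_def)
  then show ?thesis by (simp add: sum.delta)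
qed

lemma tensor_apply_right:
  assumes "y \<in> tensor_space l"
  shows "(x \<otimes>\<^sub>v y) K =
    (if l \<le> length K then x (take (length K - l) K) * y (drop (length K - l) K) else 0)"
proof -
  have "(x \<otimes>\<^sub>v y) K = (\<Sum>i\<le>length K. if i = length K - l \<and> l \<le> length K
      then x (take i K) * y (drop i K) else 0)"
    unfolding tensor_def using assms by (intro sum.cong) (auto simp: tensor_space_def)
  then show ?thesis by (cases "l \<le> length K") (simp_all add: sum.delta)
qed

lemma tensor_space_eqI:
  assumes "x \<in> tensor_space m" "y \<in> tensor_space m" "\<And>J. length J = m \<Longrightarrow> x J = y J"
  shows "x = y"
  using assms by (intro ext) (metis (mono_tags, lifting) mem_Collect_eq tensor_space_def)

lemma tensor_space_nonzeroE:
  assumes "x \<in> tensor_space m" "x \<noteq> (\<lambda>_. 0)"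
  obtains L where "length L = m" "x L \<noteq> 0"
  using assms unfolding tensor_space_def by force

lemma tensor_space_degree_unique:
  assumes "x \<in> tensor_space m" "x \<in> tensor_space l" "x \<noteq> (\<lambda>_. 0)"
  shows "m = l"
  using assms unfolding tensor_space_def by force

lemma tensor_space_cmult: "x \<in> tensor_space m \<Longrightarrow> (\<lambda>J. c * x J) \<in> tensor_space m"
  by (simp add: tensor_space_def)

lemma tensor_cmult_left: "(\<lambda>J. c * x J) \<otimes>\<^sub>v y = (\<lambda>J. c * (x \<otimes>\<^sub>v y) J)"
  by (rule ext) (simp add: tensor_def sum_distrib_left mult.assoc)

lemma tensor_cmult_right: "x \<otimes>\<^sub>v (\<lambda>J. c * y J) = (\<lambda>J. c * (x \<otimes>\<^sub>v y) J)"
  by (rule ext) (simp add: tensor_def sum_distrib_left mult.left_commute)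

lemma tensor_assoc:
  assumes "x \<in> tensor_space m" "y \<in> tensor_space l"
  shows "(x \<otimes>\<^sub>v y) \<otimes>\<^sub>v w = x \<otimes>\<^sub>v y \<otimes>\<^sub>v w"
  using tensor_homogeneous(1)[OF assms] assms
  by (intro ext) (auto simp: tensor_apply_left min_def drop_take add.commute)

lemma tensor_unit_left:
  fixes y :: "'n::finite list \<Rightarrow> complex"
  shows "tensor_power x 0 \<otimes>\<^sub>v y = y"
  by (rule ext, subst tensor_apply_left[where m = 0]) (auto simp: tensor_space_def)

lemma tensor_unit_right:
  fixes y :: "'n::finite list \<Rightarrow> complex"
  shows "y \<otimes>\<^sub>v tensor_power x 0 = y"
  by (rule ext, subst tensor_apply_right[where l = 0]) (auto simp: tensor_space_def)

lemma tensor_degree_zero_left: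
  assumes "x \<in> tensor_space 0"
  shows "x \<otimes>\<^sub>v y = (\<lambda>J. x [] * y J)"
  using assms by (intro ext) (simp add: tensor_apply_left)

lemma tensor_degree_zero_right:
  assumes "x \<in> tensor_space 0"
  shows "y \<otimes>\<^sub>v x = (\<lambda>J. x [] * y J)"
  using assms by (intro ext) (simp add: tensor_apply_right)

lemma tensor_nonzero:
  assumes "x \<in> tensor_space m" "x \<noteq> (\<lambda>_. 0)" "y \<noteq> (\<lambda>_. 0)"
  shows "x \<otimes>\<^sub>v y \<noteq> (\<lambda>_. 0)"
proof -
  obtain L where L: "length L = m" "x L \<noteq> 0" using assms tensor_space_nonzeroE by blast
  obtain K where K: "y K \<noteq> 0" using assms(3) by blast
  have "(x \<otimes>\<^sub>v y) (L @ K) \<noteq> 0" using L K by (simp add: tensor_apply_left[OF assms(1)])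
  then show ?thesis by metis
qed

lemma tensor_left_cancel:
  assumes "x \<in> tensor_space m" "x \<noteq> (\<lambda>_. 0)" "x \<otimes>\<^sub>v a = x \<otimes>\<^sub>v b"
  shows "a = b"
proof
  fix J
  obtain L where L: "length L = m" "x L \<noteq> 0" using assms tensor_space_nonzeroE by blast
  have "(x \<otimes>\<^sub>v a) (L @ J) = (x \<otimes>\<^sub>v b) (L @ J)" using assms(3) by simp
  then show "a J = b J" using L by (simp add: tensor_apply_left[OF assms(1)])
qed

lemma tensor_power_in: "x \<in> tensor_space m \<Longrightarrow> tensor_power x p \<in> tensor_space (p * m)"
proof (induction p)
  case 0
  then show ?case by (simp add: tensor_space_def)
next
  case (Suc p)
  then show ?case using tensor_homogeneous(1) by auto
qed

lemma tensor_power_nonzero: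
  "x \<in> tensor_space m \<Longrightarrow> x \<noteq> (\<lambda>_. 0) \<Longrightarrow> tensor_power x p \<noteq> (\<lambda>_. 0)"
proof (induction p)
  case 0
  show ?case by (auto dest: fun_cong[of _ _ "[]"])
next
  case (Suc p)
  then show ?case using tensor_nonzero by auto
qed

lemma tensor_power_add:
  assumes "x \<in> tensor_space m"
  shows "tensor_power x (p + q) = tensor_power x p \<otimes>\<^sub>v tensor_power x q"
proof (induction p)
  case 0
  show ?case by (simp only: tensor_unit_left add_0)
next
  case (Suc p)
  then show ?case using tensor_assoc[OF assms tensor_power_in[OF assms]] by simp
qed

lemma tensor_power_cmult: "tensor_power (\<lambda>J. c * x J) p = (\<lambda>J. c ^ p * tensor_power x p J)"
  by (induction p) (auto simp: tensor_cmult_left tensor_cmult_right mult.assoc)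

lemma tensor_power_one:
  fixes x :: "'n::finite list \<Rightarrow> complex"
  shows "tensor_power x 1 = x"
  using tensor_unit_right[of x x] by simp

lemma tensor_power_commutes:
  assumes "x \<in> tensor_space m"
  shows "x \<otimes>\<^sub>v tensor_power x p = tensor_power x p \<otimes>\<^sub>v x"
  using tensor_power_add[OF assms, of 1 p] tensor_power_add[OF assms, of p 1]
  by (simp add: tensor_power_one add.commute del: tensor_power.simps One_nat_def)

text \<open>Evaluating both sides at words that end in a fixed \<open>L\<close> with \<open>d L \<noteq> 0\<close> writes \<open>c\<close> as \<open>a\<close> times a
  slice of \<open>b\<close>: the analogue for tensors of Levi's lemma on equal concatenations of words.\<close>

lemma tensor_levi:
  assumes "a \<in> tensor_space m" "c \<in> tensor_space l" "m \<le> l" "d \<in> tensor_space r"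
    and "d \<noteq> (\<lambda>_. 0)" and eq: "a \<otimes>\<^sub>v b = c \<otimes>\<^sub>v d"
  obtains u where "u \<in> tensor_space (l - m)" "c = a \<otimes>\<^sub>v u"
proof -
  obtain L where L: "length L = r" "d L \<noteq> 0" using assms(4,5) tensor_space_nonzeroE by blast
  define u where "u J = (if length J = l - m then b (J @ L) / d L else 0)" for J
  have u: "u \<in> tensor_space (l - m)" by (simp add: u_def tensor_space_def)
  have "c = a \<otimes>\<^sub>v u"
  proof (rule tensor_space_eqI[OF assms(2)])
    show "a \<otimes>\<^sub>v u \<in> tensor_space l" using tensor_homogeneous(1)[OF assms(1) u] assms(3) by simp
    fix K :: "'a list" assume K: "length K = l"
    have "(a \<otimes>\<^sub>v b) (K @ L) = (c \<otimes>\<^sub>v d) (K @ L)" using eq by simp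
    then have "a (take m K) * b (drop m K @ L) = c K * d L"
      using K assms(3) by (simp add: tensor_apply_left[OF assms(1)] tensor_apply_left[OF assms(2)])
    then show "c K = (a \<otimes>\<^sub>v u) K"
      using K L assms(3) by (simp add: tensor_apply_left[OF assms(1)] u_def field_simps)
  qed
  with u that show thesis by blast
qed

text \<open>The Euclidean algorithm on the degrees: the factor of smaller degree, say \<open>b\<close>, splits off from the left
  of \<open>a\<close>, and the cofactor again commutes with \<open>b\<close> up to \<open>\<kappa>\<close>.  The scalar must be admitted because
  splitting common left factors determines tensors only up to scalars.\<close>

lemma tensor_quasi_commuting_common_root:
  fixes a b :: "'n::finite list \<Rightarrow> complex"
  assumes "a \<in> tensor_space m" "b \<in> tensor_space r" "a \<noteq> (\<lambda>_. 0)" "b \<noteq> (\<lambda>_. 0)"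
    and "1 \<le> m" "1 \<le> r" and "a \<otimes>\<^sub>v b = (\<lambda>J. \<kappa> * (b \<otimes>\<^sub>v a) J)"
  shows "\<exists>k\<ge>1. \<exists>x\<in>tensor_space k. \<exists>p\<ge>1. \<exists>q\<ge>1. \<exists>\<alpha> \<beta>.
    a = (\<lambda>J. \<alpha> * tensor_power x p J) \<and> b = (\<lambda>J. \<beta> * tensor_power x q J)"
  using assms
proof (induction "m + r" arbitrary: a b m r \<kappa> rule: less_induct)
  case less
  \<comment> \<open>One step of the Euclidean algorithm on the degrees, with the pair \<open>a\<close>, \<open>b\<close> in either order.\<close>
  have step: "\<exists>k\<ge>1. \<exists>x\<in>tensor_space k. \<exists>p\<ge>1. \<exists>q\<ge>1. \<exists>\<alpha> \<beta>.
      a = (\<lambda>J. \<alpha> * tensor_power x p J) \<and> b = (\<lambda>J. \<beta> * tensor_power x q J)"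
    if mr: "m' + r' = m + r" "r' \<le> m'" and a: "a \<in> tensor_space m'" "a \<noteq> (\<lambda>_. 0)"
      and b: "b \<in> tensor_space r'" "b \<noteq> (\<lambda>_. 0)" and r: "1 \<le> r'"
      and eq: "a \<otimes>\<^sub>v b = (\<lambda>J. \<mu> * (b \<otimes>\<^sub>v a) J)" for a b :: "'n list \<Rightarrow> complex" and m' r' \<mu>
  proof -
    have "b \<otimes>\<^sub>v (\<lambda>J. \<mu> * a J) = a \<otimes>\<^sub>v b" using eq by (simp add: tensor_cmult_right)
    then obtain u where u: "u \<in> tensor_space (m' - r')" and au: "a = b \<otimes>\<^sub>v u"
      using tensor_levi[OF b(1) a(1) mr(2) b(1,2)] by blast
    have u0: "u \<noteq> (\<lambda>_. 0)" using a(2) au by (auto simp: tensor_def)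
    show ?thesis
    proof (cases "r' = m'")
      case True
      then have "a = (\<lambda>J. u [] * tensor_power b 1 J)" "b = (\<lambda>J. 1 * tensor_power b 1 J)"
        using au u by (simp_all add: tensor_degree_zero_right tensor_power_one del: One_nat_def)
      with b(1) r show ?thesis by (metis order_refl)
    next
      case False
      have "b \<otimes>\<^sub>v (u \<otimes>\<^sub>v b) = b \<otimes>\<^sub>v (\<lambda>J. \<mu> * (b \<otimes>\<^sub>v u) J)"
        using eq tensor_assoc[OF b(1) u, of b] by (simp add: au tensor_cmult_right)
      from tensor_left_cancel[OF b this] have ub: "u \<otimes>\<^sub>v b = (\<lambda>J. \<mu> * (b \<otimes>\<^sub>v u) J)" .
      have "m' - r' + r' < m + r" "1 \<le> m' - r'" using False mr r by auto
      from less(1)[OF this(1) u b(1) u0 b(2) this(2) r ub]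
      obtain k x p q \<alpha> \<beta> where k: "k \<ge> 1" "x \<in> tensor_space k" "p \<ge> 1" "q \<ge> 1"
        and u': "u = (\<lambda>J. \<alpha> * tensor_power x p J)" and b': "b = (\<lambda>J. \<beta> * tensor_power x q J)"
        by blast
      have "a = (\<lambda>J. (\<beta> * \<alpha>) * tensor_power x (q + p) J)"
        by (simp add: au u' b' tensor_cmult_left tensor_cmult_right tensor_power_add[OF k(2)]
            mult.assoc mult.left_commute)
      with k b' show ?thesis by (metis trans_le_add1)
    qed
  qed
  show ?case
  proof (cases "r \<le> m")
    case True
    from step[OF refl True less(2,4,3,5,7,8)] show ?thesis .
  next
    case False
    have "\<kappa> \<noteq> 0" using tensor_nonzero[OF less(2,4,5)] less(8) by auto
    then have "b \<otimes>\<^sub>v a = (\<lambda>J. inverse \<kappa> * (a \<otimes>\<^sub>v b) J)"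
      using less(8) by (simp add: mult.assoc[symmetric])
    from step[OF _ _ less(3,5,2,4,6) this] False show ?thesis by (metis add.commute nat_le_linear)
  qed
qed

text \<open>A common root \<open>x\<close> of \<open>t\<close> and \<open>z\<close> has degree at most \<open>k < m\<close>, so \<open>z = \<alpha> x\<^sup>p\<close> with \<open>p \<ge> 2\<close>; a \<open>p\<close>-th root
  of \<open>\<alpha>\<close> turns this into an honest power, against nonperiodicity.\<close>

lemma nonperiodic_not_quasi_commuting:
  assumes "nonperiodic z" and z: "z \<in> tensor_space m" "z \<noteq> (\<lambda>_. 0)"
    and t: "t \<in> tensor_space k" "t \<noteq> (\<lambda>_. 0)" and "1 \<le> k" "k < m"
  shows "t \<otimes>\<^sub>v z \<noteq> (\<lambda>J. \<kappa> * (z \<otimes>\<^sub>v t) J)"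
proof
  assume "t \<otimes>\<^sub>v z = (\<lambda>J. \<kappa> * (z \<otimes>\<^sub>v t) J)"
  moreover have "1 \<le> m" using assms by linarith
  ultimately obtain d x q p \<beta> \<alpha> where x: "d \<ge> 1" "x \<in> tensor_space d" "q \<ge> 1" "p \<ge> 1"
    and t': "t = (\<lambda>J. \<beta> * tensor_power x q J)" and z': "z = (\<lambda>J. \<alpha> * tensor_power x p J)"
    using tensor_quasi_commuting_common_root[OF t(1) z(1) t(2) z(2) \<open>1 \<le> k\<close>, of \<kappa>] by blast
  have "t \<in> tensor_space (q * d)" "z \<in> tensor_space (p * d)"
    unfolding t' z' by (intro tensor_space_cmult tensor_power_in x)+
  then have "q * d = k" "p * d = m" using t z tensor_space_degree_unique by metis+
  then have "p \<noteq> 1" using \<open>k < m\<close> x by auto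
  have "\<exists>\<gamma>. \<gamma> ^ p = \<alpha>" using x(4)
    by (metis exists_complex_root not_one_le_zero)
  then obtain \<gamma> where "\<gamma> ^ p = \<alpha>" ..
  then have "z = tensor_power (\<lambda>J. \<gamma> * x J) p" by (simp add: z' tensor_power_cmult)
  with assms(1) x \<open>p \<noteq> 1\<close> show False
    unfolding nonperiodic_def using tensor_space_cmult by blast
qed

text \<open>Left factors \<open>z\<close> can be split off from \<open>t\<close> until its degree \<open>k\<close> is below \<open>m\<close>.  If then \<open>0 < k\<close>, the
  left factors of degree \<open>m + k\<close> of the two products show that \<open>t\<close> commutes with \<open>z\<close> itself, up to a
  scalar, which is impossible.\<close>

lemma tensor_commute_with_power_degree_dvd:
  assumes "nonperiodic z" and z: "z \<in> tensor_space m" "z \<noteq> (\<lambda>_. 0)"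
    and "t \<in> tensor_space k" "t \<noteq> (\<lambda>_. 0)" and "1 \<le> m" "1 \<le> l"
    and "t \<otimes>\<^sub>v tensor_power z l = tensor_power z l \<otimes>\<^sub>v t"
  shows "m dvd k"
  using assms(4,5,8)
proof (induction k arbitrary: t rule: less_induct)
  case (less k t)
  note t = less.prems(1,2) and comm = less.prems(3)
  obtain l' where l': "l = Suc l'" using \<open>1 \<le> l\<close> by (cases l) auto
  note pw = tensor_power_in[OF z(1)] and pw0 = tensor_power_nonzero[OF z]
  show ?case
  proof (cases "k = 0")
    case True
    then show ?thesis by simp
  next
    case False
    have eq: "t \<otimes>\<^sub>v tensor_power z l = z \<otimes>\<^sub>v tensor_power z l' \<otimes>\<^sub>v t"
      unfolding comm by (simp add: l' tensor_assoc[OF z(1) pw])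
    show ?thesis
    proof (cases "m \<le> k")
      case True
      obtain u where u: "u \<in> tensor_space (k - m)" "t = z \<otimes>\<^sub>v u"
        using tensor_levi[OF z(1) t(1) True pw pw0 eq[symmetric]] .
      have u0: "u \<noteq> (\<lambda>_. 0)" using t(2) u(2) by (auto simp: tensor_def)
      have "z \<otimes>\<^sub>v u \<otimes>\<^sub>v tensor_power z l = z \<otimes>\<^sub>v tensor_power z l \<otimes>\<^sub>v u"
      proof -
        have "z \<otimes>\<^sub>v u \<otimes>\<^sub>v tensor_power z l = tensor_power z l \<otimes>\<^sub>v z \<otimes>\<^sub>v u"
          using comm tensor_assoc[OF z(1) u(1)] by (simp add: u(2))
        also have "\<dots> = (z \<otimes>\<^sub>v tensor_power z l) \<otimes>\<^sub>v u"
          using tensor_assoc[OF pw z(1)] tensor_power_commutes[OF z(1)] by simp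
        finally show ?thesis using tensor_assoc[OF z(1) pw] by simp
      qed
      from tensor_left_cancel[OF z this] less.IH[OF _ u(1) u0] False True \<open>1 \<le> m\<close>
      have "m dvd k - m" by simp
      with True show ?thesis by (simp add: dvd_minus_self)
    next
      case nle: False
      then obtain u where u: "u \<in> tensor_space (m - k)" "z = t \<otimes>\<^sub>v u"
        using tensor_levi[OF t(1) z(1) _ tensor_homogeneous(1)[OF pw t(1)]
            tensor_nonzero[OF pw pw0 t(2)] eq] by auto
      \<comment> \<open>Both sides of \<open>eq\<close> have a left factor of degree \<open>m + k\<close>: \<open>t z\<close> on the left, \<open>z t\<close> on the right.\<close>
      obtain w where "(t \<otimes>\<^sub>v z) \<otimes>\<^sub>v tensor_power z l' = (z \<otimes>\<^sub>v t) \<otimes>\<^sub>v w"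
      proof (cases l')
        case 0
        then have "(t \<otimes>\<^sub>v z) \<otimes>\<^sub>v tensor_power z l' = (z \<otimes>\<^sub>v t) \<otimes>\<^sub>v tensor_power z 0"
          using eq by (simp only: l' tensor_power.simps(2) tensor_unit_left tensor_unit_right)
        with that show ?thesis .
      next
        case (Suc l'')
        have "(t \<otimes>\<^sub>v z) \<otimes>\<^sub>v tensor_power z l' = z \<otimes>\<^sub>v tensor_power z l' \<otimes>\<^sub>v t"
          using eq tensor_assoc[OF t(1) z(1)] by (simp add: l')
        also have "\<dots> = z \<otimes>\<^sub>v t \<otimes>\<^sub>v (u \<otimes>\<^sub>v tensor_power z l'') \<otimes>\<^sub>v t"
          using tensor_assoc[OF t(1) u(1)]
            tensor_assoc[OF t(1) tensor_homogeneous(1)[OF u(1) pw]] by (simp add: Suc u(2))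
        also have "\<dots> = (z \<otimes>\<^sub>v t) \<otimes>\<^sub>v (u \<otimes>\<^sub>v tensor_power z l'') \<otimes>\<^sub>v t"
          using tensor_assoc[OF z(1) t(1)] by simp
        finally show ?thesis by (rule that)
      qed
      moreover have "t \<otimes>\<^sub>v z \<in> tensor_space (m + k)" "z \<otimes>\<^sub>v t \<in> tensor_space (m + k)"
        using tensor_homogeneous(1)[OF t(1) z(1)] tensor_homogeneous(1)[OF z(1) t(1)]
        by (simp_all add: add.commute)
      ultimately obtain c where "c \<in> tensor_space 0" "t \<otimes>\<^sub>v z = (z \<otimes>\<^sub>v t) \<otimes>\<^sub>v c"
        using tensor_levi[of "z \<otimes>\<^sub>v t" "m + k" "t \<otimes>\<^sub>v z" "m + k" "tensor_power z l'"] pw pw0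
        by (metis diff_self_eq_0 order_refl)
      then have "t \<otimes>\<^sub>v z = (\<lambda>J. c [] * (z \<otimes>\<^sub>v t) J)"
        by (simp add: tensor_degree_zero_right)
      with nonperiodic_not_quasi_commuting[OF assms(1) z t] False nle show ?thesis by auto
    qed
  qed
qed


section \<open>Tensors of correlations\<close>

lemma finite_words [simp]: "finite {J :: 'n::finite list. length J = m}"
  using finite_lists_length_eq[of "UNIV :: 'n set"] by simp

lemma sum_words_append:
  fixes f :: "'n::finite list \<Rightarrow> 'b::comm_monoid_add"
  shows "(\<Sum>J | length J = k + m. f J) = (\<Sum>J | length J = k. \<Sum>K | length K = m. f (J @ K))"
  unfolding sum.cartesian_product
  by (rule sum.reindex_bij_witness[where j = "\<lambda>L. (take k L, drop k L)" and i = "\<lambda>(J, K). J @ K"])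
     auto

lemma unit_vectors_nonzero: "x \<in> unit_vectors m \<Longrightarrow> x \<noteq> (\<lambda>_. 0)"
  by (auto simp: unit_vectors_def)

lemma unit_vectors_tensor_space: "x \<in> unit_vectors m \<Longrightarrow> x \<in> tensor_space m"
  by (simp add: unit_vectors_def)

lemma unit_vectors_sum: "x \<in> unit_vectors m \<Longrightarrow> (\<Sum>J | length J = m. (cmod (x J))\<^sup>2) = 1"
  by (simp add: unit_vectors_def)

definition degree_part :: "nat \<Rightarrow> ('n list \<Rightarrow> complex) \<Rightarrow> 'n list \<Rightarrow> complex" where
  "degree_part k v = (\<lambda>J. if length J = k then v J else 0)"

lemma degree_part_in: "degree_part k v \<in> tensor_space k"
  by (simp add: degree_part_def tensor_space_def)

lemma degree_part_tensor_left:
  assumes "y \<in> tensor_space l" and "\<And>K J. length K = l \<Longrightarrow> v (K @ J) = y K * v J"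
  shows "degree_part (k + l) v = y \<otimes>\<^sub>v degree_part k v"
proof (rule tensor_space_eqI[OF degree_part_in])
  show "y \<otimes>\<^sub>v degree_part k v \<in> tensor_space (k + l)"
    using tensor_homogeneous(1)[OF assms(1) degree_part_in] by (simp add: add.commute)
  fix J :: "'a list" assume "length J = k + l"
  then show "degree_part (k + l) v J = (y \<otimes>\<^sub>v degree_part k v) J"
    using assms(2)[of "take l J" "drop l J"]
    by (simp add: tensor_apply_left[OF assms(1)] degree_part_def)
qed

text \<open>With \<open>N k = \<parallel>v\<^sub>k\<parallel>\<^sup>2\<close>, the hypothesis on \<open>z\<close> gives \<open>\<parallel>v\<^sub>k\<^sub>+\<^sub>m - v\<^sub>k \<otimes> z\<parallel>\<^sup>2 = N (k + m) - N k\<close>, and the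
  hypothesis on \<open>y\<close> gives \<open>N (k + l) = N k\<close>.  So \<open>N\<close> does not decrease along steps of length \<open>m\<close> and returns to
  its value after \<open>l\<close> such steps; it is constant along them and the defect vanishes.\<close>

lemma degree_part_tensor_right:
  assumes z: "z \<in> unit_vectors m" and y: "y \<in> unit_vectors l" and "1 \<le> l"
    and yv: "\<And>K J. length K = l \<Longrightarrow> v (K @ J) = y K * v J"
    and zv: "\<And>J. v J = (\<Sum>K | length K = m. cnj (z K) * v (J @ K))"
  shows "degree_part (k + m) v = degree_part k v \<otimes>\<^sub>v z"
proof -
  define N where "N k = (\<Sum>J | length J = k. (cmod (v J))\<^sup>2)" for k
  have Nl: "N (l + k) = N k" for k
    by (simp add: N_def sum_words_append yv norm_mult power_mult_distrib
        unit_vectors_sum[OF y] flip: sum_distrib_left sum_distrib_right)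
  have defect: "(\<Sum>J | length J = k. \<Sum>K | length K = m. (cmod (v (J @ K) - v J * z K))\<^sup>2)
      = N (k + m) - N k" for k
  proof -
    have "(\<Sum>K | length K = m. (cmod (v (J @ K) - v J * z K))\<^sup>2)
        = (\<Sum>K | length K = m. (cmod (v (J @ K)))\<^sup>2) - (cmod (v J))\<^sup>2" for J
    proof -
      have sq: "(cmod (a - b * c))\<^sup>2 = (cmod a)\<^sup>2 + (cmod b)\<^sup>2 * (cmod c)\<^sup>2
          - 2 * Re (cnj b * (cnj c * a))" for a b c :: complex
        unfolding cmod_power2 by (simp add: power2_eq_square algebra_simps)
      have "Re (\<Sum>K | length K = m. cnj (v J) * (cnj (z K) * v (J @ K))) = (cmod (v J))\<^sup>2"
        by (simp add: complex_norm_square[symmetric] mult.commute flip: sum_distrib_left zv)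
      then show ?thesis
        by (simp add: sq sum.distrib sum_subtractf unit_vectors_sum[OF z]
            flip: sum_distrib_left)
    qed
    then show ?thesis by (simp add: N_def sum_words_append sum_subtractf)
  qed
  have le: "N k \<le> N (k + m)" for k
  proof -
    have "0 \<le> N (k + m) - N k" unfolding defect[symmetric] by (intro sum_nonneg) auto
    then show ?thesis by simp
  qed
  have up: "N k \<le> N (k + p * m)" for k p
  proof (induction p)
    case (Suc p)
    then show ?case using le[of "k + p * m"] by (simp add: algebra_simps)
  qed simp
  have per: "N (k + p * l) = N k" for k p
  proof (induction p)
    case (Suc p)
    then show ?case using Nl[of "k + p * l"] by (simp add: algebra_simps)
  qed simp
  obtain l' where l': "l = Suc l'" using \<open>1 \<le> l\<close> by (cases l) auto
  have "N (k + m) \<le> N (k + m + l' * m)" by (rule up)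
  also have "\<dots> = N k" using per[of k m] by (simp add: l' algebra_simps)
  finally have "N (k + m) - N k = 0" using le[of k] by simp
  then have "(\<Sum>J | length J = k. \<Sum>K | length K = m. (cmod (v (J @ K) - v J * z K))\<^sup>2) = 0"
    by (simp add: defect)
  then have zero: "v (J @ K) = v J * z K" if "length J = k" "length K = m" for J K
    using that by (simp add: sum_nonneg_eq_0_iff sum_nonneg)
  show ?thesis
  proof (rule tensor_space_eqI[OF degree_part_in])
    show "degree_part k v \<otimes>\<^sub>v z \<in> tensor_space (k + m)"
      using tensor_homogeneous(1)[OF degree_part_in] unit_vectors_tensor_space[OF z] .
    fix J :: "'a list" assume "length J = k + m"
    then show "degree_part (k + m) v J = (degree_part k v \<otimes>\<^sub>v z) J"
      using zero[of "take k J" "drop k J"]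
      by (simp add: tensor_apply_left[OF degree_part_in]) (simp add: degree_part_def)
  qed
qed

text \<open>Both sides are the alternating product \<open>x \<otimes> u \<otimes> x \<otimes> \<dots> \<otimes> u \<otimes> x\<close>.\<close>

lemma tensor_power_intertwine:
  assumes "x \<in> tensor_space k" "u \<in> tensor_space r"
  shows "tensor_power (x \<otimes>\<^sub>v u) p \<otimes>\<^sub>v x = x \<otimes>\<^sub>v tensor_power (u \<otimes>\<^sub>v x) p"
proof (induction p)
  case 0
  show ?case by (simp only: tensor_unit_left tensor_unit_right)
next
  case (Suc p)
  note xu = tensor_homogeneous(1)[OF assms] and ux = tensor_homogeneous(1)[OF assms(2,1)]
  show ?case
    using Suc tensor_assoc[OF xu tensor_power_in[OF xu]] tensor_assoc[OF assms]
      tensor_assoc[OF assms(2,1)] by simp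
qed

text \<open>The least degree \<open>k\<close> in which \<open>v\<close> does not vanish is below \<open>l\<close>, because degree \<open>k\<close> arises from degree
  \<open>k - l\<close> otherwise.  Reaching degree \<open>k + l m\<close> from \<open>k\<close> in the two possible ways yields
  \<open>y\<^sup>m \<otimes> x = x \<otimes> z\<^sup>l\<close> for \<open>x = v\<^sub>k\<close>, from which \<open>y = x \<otimes> u\<close> and \<open>(u \<otimes> x)\<^sup>m = z\<^sup>l\<close>.\<close>

lemma correlation_conjugates:
  assumes z: "z \<in> unit_vectors m" and y: "y \<in> unit_vectors l" and "1 \<le> l" "1 \<le> m"
    and "nonperiodic z"
    and yv: "\<And>K J. length K = l \<Longrightarrow> v (K @ J) = y K * v J"
    and zv: "\<And>J. v J = (\<Sum>K | length K = m. cnj (z K) * v (J @ K))"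
    and "v J0 \<noteq> 0"
  obtains k x u where "k < l" "x \<in> tensor_space k" "x \<noteq> (\<lambda>_. 0)" "u \<in> tensor_space (l - k)"
    "y = x \<otimes>\<^sub>v u" "m dvd l" "m = l \<Longrightarrow> z = u \<otimes>\<^sub>v x"
proof -
  note yT = unit_vectors_tensor_space[OF y] and y0 = unit_vectors_nonzero[OF y]
  note zT = unit_vectors_tensor_space[OF z] and z0 = unit_vectors_nonzero[OF z]
  have left: "degree_part (k + l) v = y \<otimes>\<^sub>v degree_part k v" for k
    using degree_part_tensor_left[OF yT yv] .
  have right: "degree_part (k + m) v = degree_part k v \<otimes>\<^sub>v z" for k
    using degree_part_tensor_right[OF z y \<open>1 \<le> l\<close> yv zv] .
  define k where "k = (LEAST k. degree_part k v \<noteq> (\<lambda>_. 0))"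
  have "degree_part (length J0) v \<noteq> (\<lambda>_. 0)"
    using \<open>v J0 \<noteq> 0\<close> by (auto simp: degree_part_def dest: fun_cong[of _ _ J0])
  then have k: "degree_part k v \<noteq> (\<lambda>_. 0)" unfolding k_def by (rule LeastI)
  have least: "degree_part i v = (\<lambda>_. 0)" if "i < k" for i
    using not_less_Least[of i] that unfolding k_def by blast
  define x where "x = degree_part k v"
  have x: "x \<in> tensor_space k" "x \<noteq> (\<lambda>_. 0)" using k by (simp_all add: x_def degree_part_in)
  have "k < l"
  proof (rule ccontr)
    assume "\<not> k < l"
    then have "degree_part k v = y \<otimes>\<^sub>v (\<lambda>_. 0)"
      using left[of "k - l"] least[of "k - l"] \<open>1 \<le> l\<close> by simp
    with k show False by (simp add: tensor_def fun_eq_iff)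
  qed
  have leftp: "degree_part (k + p * l) v = tensor_power y p \<otimes>\<^sub>v x" for p
  proof (induction p)
    case 0
    show ?case unfolding tensor_unit_left by (simp add: x_def)
  next
    case (Suc p)
    then show ?case
      using left[of "k + p * l"] tensor_assoc[OF yT tensor_power_in[OF yT]]
      by (simp add: algebra_simps)
  qed
  have rightp: "degree_part (k + p * m) v = x \<otimes>\<^sub>v tensor_power z p" for p
  proof (induction p)
    case 0
    show ?case unfolding tensor_unit_right by (simp add: x_def)
  next
    case (Suc p)
    then show ?case
      using right[of "k + p * m"] tensor_assoc[OF x(1) tensor_power_in[OF zT], of p z]
      by (simp add: algebra_simps tensor_power_commutes[OF zT])
  qed
  have eq: "tensor_power y m \<otimes>\<^sub>v x = x \<otimes>\<^sub>v tensor_power z l"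
    unfolding leftp[symmetric] rightp[symmetric] by (simp add: mult.commute)
  obtain m' where m': "m = Suc m'" using \<open>1 \<le> m\<close> by (cases m) auto
  note pT = tensor_power_in[OF yT, of m']
  have "x \<otimes>\<^sub>v tensor_power z l = y \<otimes>\<^sub>v tensor_power y m' \<otimes>\<^sub>v x"
    using eq tensor_assoc[OF yT pT] by (simp add: m')
  then obtain u where u: "u \<in> tensor_space (l - k)" "y = x \<otimes>\<^sub>v u"
    using tensor_levi[OF x(1) yT _ tensor_homogeneous(1)[OF pT x(1)]
        tensor_nonzero[OF pT tensor_power_nonzero[OF yT y0] x(2)]] \<open>k < l\<close>
    by (metis less_imp_le)
  note uxT = tensor_homogeneous(1)[OF u(1) x(1)]
  have "u \<noteq> (\<lambda>_. 0)" using y0 u(2) by (auto simp: tensor_def)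
  then have ux0: "u \<otimes>\<^sub>v x \<noteq> (\<lambda>_. 0)" using tensor_nonzero[OF u(1) _ x(2)] by blast
  have "x \<otimes>\<^sub>v tensor_power (u \<otimes>\<^sub>v x) m = x \<otimes>\<^sub>v tensor_power z l"
    using eq tensor_power_intertwine[OF x(1) u(1)] by (simp add: u(2))
  from tensor_left_cancel[OF x this] have "tensor_power (u \<otimes>\<^sub>v x) m = tensor_power z l" .
  then have "m dvd l"
    using tensor_commute_with_power_degree_dvd[OF \<open>nonperiodic z\<close> zT z0 uxT ux0 \<open>1 \<le> m\<close> \<open>1 \<le> l\<close>]
      tensor_power_commutes[OF uxT, of m] \<open>k < l\<close> by simp
  moreover have "z = u \<otimes>\<^sub>v x" if "m = l"
  proof -
    have "x \<otimes>\<^sub>v z = x \<otimes>\<^sub>v u \<otimes>\<^sub>v x"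
      using left[of k] right[of k] tensor_assoc[OF x(1) u(1)] that by (simp add: u(2) x_def)
    from tensor_left_cancel[OF x this] show ?thesis .
  qed
  ultimately show thesis using that \<open>k < l\<close> x u by blast
qed

text \<open>For two equal fixed vectors the recursions from the left and from the right make \<open>z\<close> commute with
  every homogeneous part of \<open>v\<close>, and only the zero tensor of degree strictly between \<open>0\<close> and \<open>m\<close> does.\<close>

lemma self_correlation_vanishes:
  assumes z: "z \<in> unit_vectors m" and "1 \<le> m" and "nonperiodic z"
    and vz: "\<And>K J. length K = m \<Longrightarrow> v (K @ J) = z K * v J"
    and zv: "\<And>J. v J = (\<Sum>K | length K = m. cnj (z K) * v (J @ K))"
    and J: "0 < length J" "length J < m"
  shows "v J = 0"
proof (rule ccontr)
  assume "v J \<noteq> 0"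
  note zT = unit_vectors_tensor_space[OF z] and z0 = unit_vectors_nonzero[OF z]
  define t where "t = degree_part (length J) v"
  have "t J \<noteq> 0" using \<open>v J \<noteq> 0\<close> by (simp add: t_def degree_part_def)
  then have t: "t \<in> tensor_space (length J)" "t \<noteq> (\<lambda>_. 0)"
    by (auto simp: t_def degree_part_in)
  have "t \<otimes>\<^sub>v z = (\<lambda>J. 1 * (z \<otimes>\<^sub>v t) J)"
    using degree_part_tensor_left[OF zT vz] degree_part_tensor_right[OF z z \<open>1 \<le> m\<close> vz zv]
    by (simp add: t_def)
  moreover have "t \<otimes>\<^sub>v z \<noteq> (\<lambda>J. 1 * (z \<otimes>\<^sub>v t) J)"
    by (rule nonperiodic_not_quasi_commuting[OF \<open>nonperiodic z\<close> zT z0 t]) (use J in linarith)+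
  ultimately show False by blast
qed

lemma tensor_norm:
  fixes x :: "'n::finite list \<Rightarrow> complex"
  assumes "x \<in> tensor_space m" "y \<in> tensor_space l"
  shows "(\<Sum>J | length J = m + l. (cmod ((x \<otimes>\<^sub>v y) J))\<^sup>2) =
    (\<Sum>J | length J = m. (cmod (x J))\<^sup>2) * (\<Sum>J | length J = l. (cmod (y J))\<^sup>2)"
  by (simp add: sum_words_append tensor_homogeneous(2)[OF assms] norm_mult power_mult_distrib
      sum_product)

lemma normalize_factors:
  fixes x u :: "'n::finite list \<Rightarrow> complex"
  assumes x: "x \<in> tensor_space k" and u: "u \<in> tensor_space r" and xu: "x \<otimes>\<^sub>v u \<in> unit_vectors l"
  obtains x' u' where "x' \<in> unit_vectors k" "u' \<in> unit_vectors r"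
    "x \<otimes>\<^sub>v u = x' \<otimes>\<^sub>v u'" "u \<otimes>\<^sub>v x = u' \<otimes>\<^sub>v x'"
proof -
  have l: "l = k + r"
    using tensor_space_degree_unique[OF unit_vectors_tensor_space[OF xu]
        tensor_homogeneous(1)[OF x u] unit_vectors_nonzero[OF xu]] .
  define N where "N = (\<Sum>J | length J = k. (cmod (x J))\<^sup>2)"
  have prod: "N * (\<Sum>J | length J = r. (cmod (u J))\<^sup>2) = 1"
    using tensor_norm[OF x u] unit_vectors_sum[OF xu] by (simp add: N_def l)
  have "0 \<le> N" unfolding N_def by (intro sum_nonneg) auto
  with prod have N: "0 < N" by (cases "N = 0") auto
  define c where "c = complex_of_real (sqrt N)"
  have c: "c \<noteq> 0" "(cmod c)\<^sup>2 = N" using N by (simp_all add: c_def)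
  show thesis
  proof (rule that)
    show "(\<lambda>J. inverse c * x J) \<in> unit_vectors k"
      using c N tensor_space_cmult[OF x, of "inverse c"]
      by (simp add: unit_vectors_def norm_mult norm_inverse power_mult_distrib power_inverse
          flip: sum_distrib_left N_def)
    show "(\<lambda>J. c * u J) \<in> unit_vectors r"
      using c prod tensor_space_cmult[OF u, of c]
      by (simp add: unit_vectors_def norm_mult power_mult_distrib flip: sum_distrib_left)
  qed (simp_all add: tensor_cmult_left tensor_cmult_right c(1) mult.assoc[symmetric])
qed

section \<open>Complex Hilbert spaces\<close>

lemma cinner_add_left: "cinner (x + y) z = cinner x z + cinner y z"
  by (metis cinner_add_right cinner_commute complex_cnj_add)

lemma cinner_scaleC_left: "cinner (c *\<^sub>C x) y = cnj c * cinner x y"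
  by (metis cinner_commute cinner_scaleC_right complex_cnj_mult)

lemma cinner_zero_right [simp]: "cinner x 0 = 0"
  using cinner_scaleC_right[of x 0 0] by (simp add: scaleC_zero_left)

lemma cinner_zero_left [simp]: "cinner 0 x = 0"
  using cinner_commute[of 0 x] by simp

lemma scaleC_minus_one: "(- 1) *\<^sub>C x = - (x::'a::complex_vector)"
  using scaleR_scaleC[of "-1" x] by simp

lemma cinner_diff_right: "cinner x (y - z) = cinner x y - cinner x z"
  using cinner_add_right[of x "y - z" z] by simp

lemma cinner_diff_left: "cinner (x - y) z = cinner x z - cinner y z"
  using cinner_add_left[of "x - y" y z] by simp

lemma cinner_sum_right: "cinner x (sum f A) = (\<Sum>i\<in>A. cinner x (f i))"
  by (induction A rule: infinite_finite_induct) (auto simp: cinner_add_right)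

lemma cinner_sum_left: "cinner (sum f A) x = (\<Sum>i\<in>A. cinner (f i) x)"
  by (induction A rule: infinite_finite_induct) (auto simp: cinner_add_left)

lemma norm_diff_squared:
  fixes x y :: "'h::chilbert_space"
  shows "(norm (x - y))\<^sup>2 = (norm x)\<^sup>2 + (norm y)\<^sup>2 - 2 * Re (cinner x y)"
proof -
  have "complex_of_real ((norm (x - y))\<^sup>2)
      = complex_of_real ((norm x)\<^sup>2 + (norm y)\<^sup>2) - (cinner x y + cnj (cinner x y))"
    using cinner_commute[of y x]
    by (simp only: cinner_diff_left cinner_diff_right of_real_add flip: cinner_self) simp
  then have "Re (complex_of_real ((norm (x - y))\<^sup>2))
      = Re (complex_of_real ((norm x)\<^sup>2 + (norm y)\<^sup>2) - (cinner x y + cnj (cinner x y)))"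
    by (rule arg_cong)
  then show ?thesis by simp
qed

lemma norm_scaleC_hilbert: "norm (c *\<^sub>C (x::'h::chilbert_space)) = cmod c * norm x"
proof -
  have "complex_of_real ((norm (c *\<^sub>C x))\<^sup>2) = (c * cnj c) * complex_of_real ((norm x)\<^sup>2)"
    by (simp only: cinner_self[symmetric] cinner_scaleC_left cinner_scaleC_right mult_ac)
  also have "\<dots> = complex_of_real ((cmod c * norm x)\<^sup>2)"
    by (simp only: complex_norm_square[symmetric] of_real_mult power_mult_distrib)
  finally
  have "(norm (c *\<^sub>C x))\<^sup>2 = (cmod c * norm x)\<^sup>2" by (rule of_real_eq_iff[THEN iffD1])
  then show ?thesis by (simp add: power2_eq_iff_nonneg)
qed

lemma Re_cinner_le: "Re (cinner x y) \<le> norm x * norm (y::'h::chilbert_space)"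
proof (cases "norm x = 0 \<or> norm y = 0")
  case False
  then have pos: "norm x > 0" "norm y > 0" by auto
  have "0 \<le> (norm (norm y *\<^sub>R x - norm x *\<^sub>R y))\<^sup>2" by simp
  also have "\<dots> = 2 * (norm x * norm y) * (norm x * norm y - Re (cinner x y))"
    unfolding norm_diff_squared
    by (simp add: scaleR_scaleC cinner_scaleC_left cinner_scaleC_right norm_scaleC_hilbert
        power2_eq_square algebra_simps)
  finally show ?thesis using pos mult_pos_pos[OF pos] by (simp add: zero_le_mult_iff)
qed auto

text \<open>Rotating \<open>y\<close> by a phase makes the inner product real and nonnegative.\<close>

lemma cinner_Cauchy_Schwarz: "cmod (cinner x y) \<le> norm x * norm (y::'h::chilbert_space)"
proof (cases "cinner x y = 0")
  case False
  define c where "c = cnj (cinner x y) / cmod (cinner x y)"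
  have c: "cmod c = 1" using False by (simp add: c_def norm_divide)
  have "cinner x (c *\<^sub>C y) = (cinner x y * cnj (cinner x y)) / cmod (cinner x y)"
    by (simp add: c_def cinner_scaleC_right)
  also have "\<dots> = cmod (cinner x y)"
    using False by (simp add: power2_eq_square flip: complex_norm_square)
  finally have "Re (cinner x (c *\<^sub>C y)) = cmod (cinner x y)" by simp
  then show ?thesis using Re_cinner_le[of x "c *\<^sub>C y"] by (simp add: norm_scaleC_hilbert c)
qed simp

lemma bounded_linear_cinner_right: "bounded_linear (\<lambda>x. cinner (y::'h::chilbert_space) x)"
  by (rule bounded_linear_intro[where K = "norm y"])
     (simp_all add: cinner_add_right scaleR_scaleC cinner_scaleC_right scaleR_conv_of_real
       mult.commute[of _ "norm y"] cinner_Cauchy_Schwarz[of y])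

lemma tendsto_cinner_right:
  fixes X :: "nat \<Rightarrow> 'h::chilbert_space"
  shows "X \<longlonglongrightarrow> x \<Longrightarrow> (\<lambda>k. cinner y (X k)) \<longlonglongrightarrow> cinner y x"
  by (rule bounded_linear.tendsto[OF bounded_linear_cinner_right])

section \<open>Representations of C*-algebras\<close>

instance cstar_algebra \<subseteq> banach ..

lemma neumann_series_left_inverse:
  fixes x :: "'a::cstar_algebra"
  assumes "norm x < 1"
  obtains b where "b * (1 - x) = 1"
proof -
  have pow: "norm (x ^ Suc k) \<le> norm x ^ Suc k" for k
  proof (induction k)
    case (Suc k)
    have "norm (x * x ^ Suc k) \<le> norm x * norm (x ^ Suc k)" by (rule norm_mult_ineq)
    also have "\<dots> \<le> norm x * norm x ^ Suc k" using Suc by (intro mult_left_mono) auto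
    finally show ?case by simp
  qed simp
  have "summable (\<lambda>k. norm x ^ k)" using assms by (intro summable_geometric) simp
  then have "summable (\<lambda>k. norm x ^ Suc k)"
    using summable_Suc_iff[of "\<lambda>k. norm x ^ k"] by (rule iffD2[rotated])
  then have "summable (\<lambda>k. x ^ Suc k)" using pow by (rule summable_comparison_test')
  then have S: "summable (\<lambda>k. x ^ k)"
    using summable_Suc_iff[of "\<lambda>k. x ^ k"] by (rule iffD1[rotated])
  define b where "b = suminf (\<lambda>k. x ^ k)"
  have "b = 1 + suminf (\<lambda>k. x ^ Suc k)" using suminf_split_head[OF S] by (simp add: b_def)
  also have "suminf (\<lambda>k. x ^ Suc k) = b * x"
    using suminf_mult2[OF S, of x] by (simp only: b_def power_Suc2)
  finally have "b - b * x = 1" by (metis add_diff_cancel_right')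
  then have "b * (1 - x) = 1" by (simp add: right_diff_distrib)
  then show thesis by (rule that)
qed

lemma
  assumes "star_representation \<pi>"
  shows rep_bounded_linear: "bounded_linear (\<pi> a)"
    and rep_add_alg: "\<pi> (a + b) v = \<pi> a v + \<pi> b v"
    and rep_scaleC_alg: "\<pi> (c *\<^sub>C a) v = c *\<^sub>C \<pi> a v"
    and rep_mult: "\<pi> (a * b) v = \<pi> a (\<pi> b v)"
    and rep_one: "\<pi> 1 v = v"
    and rep_star: "cinner (\<pi> (star a) v) w = cinner v (\<pi> a w)"
  using assms unfolding star_representation_def by blast+

lemma
  assumes "star_representation \<pi>"
  shows rep_zero_alg: "\<pi> 0 v = 0"
    and rep_diff_alg: "\<pi> (a - b) v = \<pi> a v - \<pi> b v"
    and rep_sum_alg: "\<pi> (sum f A) v = (\<Sum>i\<in>A. \<pi> (f i) v)"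
    and rep_zero: "\<pi> a 0 = 0"
proof -
  note R = assms
  show 0: "\<pi> 0 v = 0" using rep_add_alg[OF R, of 0 0 v] by simp
  show "\<pi> (a - b) v = \<pi> a v - \<pi> b v" using rep_add_alg[OF R, of "a - b" b v] by simp
  show "\<pi> (sum f A) v = (\<Sum>i\<in>A. \<pi> (f i) v)"
    by (induction A rule: infinite_finite_induct) (auto simp: 0 rep_add_alg[OF R])
  interpret bounded_linear "\<pi> a" by (rule rep_bounded_linear[OF R])
  show "\<pi> a 0 = 0" by (rule zero)
qed

lemma rep_norm_squared:
  assumes "star_representation \<pi>"
  shows "cinner v (\<pi> (star a * a) v) = complex_of_real ((norm (\<pi> a v))\<^sup>2)"
  using rep_star[OF assms, of a "\<pi> a v" v] rep_star[OF assms, of "star a" v "\<pi> a v"]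
  by (simp add: rep_mult[OF assms] star_star cinner_self)

lemma rep_tendsto:
  assumes "star_representation \<pi>" "X \<longlonglongrightarrow> v"
  shows "(\<lambda>k. \<pi> a (X k)) \<longlonglongrightarrow> \<pi> a v"
  by (rule bounded_linear.tendsto[OF rep_bounded_linear[OF assms(1)] assms(2)])

text \<open>Suppose that \<open>K\<close>, the operator norm of \<open>\<pi> a\<close>, exceeds the norm of \<open>a\<close>.  Then \<open>x = K\<^sup>-\<^sup>2 a\<^sup>* a\<close> has norm below 1,
  so \<open>1 - x\<close> has a left inverse \<open>b\<close>, and \<open>1 - \<pi> x\<close> is bounded below.  On the other hand \<open>1 - \<pi> x\<close> is
  small at unit vectors where \<open>\<pi> a\<close> almost attains its norm.  This replaces the usual argument with
  spectra or square roots.\<close>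

lemma rep_contractive:
  fixes \<pi> :: "'a::cstar_algebra \<Rightarrow> 'h::chilbert_space \<Rightarrow> 'h"
  assumes R: "star_representation \<pi>"
  shows "norm (\<pi> a v) \<le> norm a * norm v"
proof -
  note bl = rep_bounded_linear[OF R]
  define K where "K = onorm (\<pi> a)"
  have K: "norm (\<pi> a v) \<le> K * norm v" for v unfolding K_def by (rule onorm[OF bl])
  have Kstar: "norm (\<pi> (star a) w) \<le> K * norm w" for w
  proof (cases "norm (\<pi> (star a) w) = 0")
    case False
    have "complex_of_real ((norm (\<pi> (star a) w))\<^sup>2) = cinner w (\<pi> a (\<pi> (star a) w))"
      using rep_star[OF R, of a w "\<pi> (star a) w"] by (simp add: cinner_self)
    then have "(norm (\<pi> (star a) w))\<^sup>2 = Re (cinner w (\<pi> a (\<pi> (star a) w)))"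
      by (metis Re_complex_of_real)
    also have "\<dots> \<le> norm w * norm (\<pi> a (\<pi> (star a) w))" by (rule Re_cinner_le)
    also have "\<dots> \<le> norm w * (K * norm (\<pi> (star a) w))" by (intro mult_left_mono K) simp
    finally show ?thesis using False by (simp add: power2_eq_square algebra_simps)
  qed (use onorm_pos_le[OF bl] in \<open>simp add: K_def\<close>)
  have "K \<le> norm a"
  proof (rule ccontr)
    assume "\<not> K \<le> norm a"
    then have less: "norm a < K" and K0: "0 < K" using norm_ge_zero[of a] by linarith+
    define x where "x = complex_of_real (1 / K\<^sup>2) *\<^sub>C (star a * a)"
    have "norm x = (norm a)\<^sup>2 / K\<^sup>2" by (simp add: x_def norm_scaleC cstar_identity norm_divide norm_power)
    also have "\<dots> < 1" using less K0 by (simp add: power_strict_mono)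
    finally obtain b where b: "b * (1 - x) = 1" by (rule neumann_series_left_inverse)
    define B where "B = onorm (\<pi> b) + 1"
    have B1: "1 \<le> B" using onorm_pos_le[OF rep_bounded_linear[OF R]] by (simp add: B_def)
    \<comment> \<open>The bound on \<open>(1 - \<pi> x)\<^sup>-\<^sup>1\<close> improves the norm of \<open>\<pi> a\<close> from \<open>K\<close> to \<open>K \<surd>q\<close>.\<close>
    define q where "q = 1 - 1 / (2 * B\<^sup>2)"
    have "1 \<le> B\<^sup>2" using B1 by simp
    then have q: "0 \<le> q" "q < 1" by (auto simp: q_def divide_le_eq)
    have "norm (\<pi> a v) \<le> K * sqrt q * norm v" for v
    proof -
      define r where "r = v - \<pi> x v"
      have "v = \<pi> b r"
        using rep_mult[OF R, of b "1 - x" v] by (simp add: b r_def rep_one[OF R] rep_diff_alg[OF R])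
      then have "norm v \<le> onorm (\<pi> b) * norm r" using onorm[OF rep_bounded_linear[OF R], of b r] by simp
      also have "\<dots> \<le> B * norm r" by (intro mult_right_mono) (simp_all add: B_def)
      finally have "(norm v)\<^sup>2 \<le> (B * norm r)\<^sup>2" by (intro power_mono) auto
      then have v: "(norm v)\<^sup>2 \<le> B\<^sup>2 * (norm r)\<^sup>2" by (simp add: power_mult_distrib)
      have inner: "Re (cinner v (\<pi> x v)) = (norm (\<pi> a v))\<^sup>2 / K\<^sup>2"
        by (simp add: x_def rep_scaleC_alg[OF R] cinner_scaleC_right rep_norm_squared[OF R]
            flip: of_real_power)
      have "norm (\<pi> x v) = norm (\<pi> (star a) (\<pi> a v)) / K\<^sup>2"
        by (simp add: x_def rep_scaleC_alg[OF R] norm_scaleC_hilbert rep_mult[OF R] norm_divide norm_power)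
      also have "\<dots> \<le> (K * (K * norm v)) / K\<^sup>2"
        using K0 by (intro divide_right_mono order_trans[OF Kstar] mult_left_mono K) auto
      also have "\<dots> = norm v" using K0 by (simp add: power2_eq_square)
      finally have "(norm (\<pi> x v))\<^sup>2 \<le> (norm v)\<^sup>2" by (intro power_mono) auto
      then have "(norm r)\<^sup>2 \<le> 2 * (norm v)\<^sup>2 - 2 * ((norm (\<pi> a v))\<^sup>2 / K\<^sup>2)"
        unfolding r_def norm_diff_squared inner by simp
      then have "B\<^sup>2 * (norm r)\<^sup>2 \<le> B\<^sup>2 * (2 * (norm v)\<^sup>2 - 2 * ((norm (\<pi> a v))\<^sup>2 / K\<^sup>2))"
        by (intro mult_left_mono) auto
      with v have "(norm v)\<^sup>2 \<le> 2 * B\<^sup>2 * ((norm v)\<^sup>2 - (norm (\<pi> a v))\<^sup>2 / K\<^sup>2)"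
        by (simp add: algebra_simps)
      then have "(norm (\<pi> a v))\<^sup>2 \<le> K\<^sup>2 * q * (norm v)\<^sup>2"
        using B1 K0 by (simp add: q_def field_simps)
      also have "\<dots> = (K * sqrt q * norm v)\<^sup>2" using q by (simp add: power_mult_distrib)
      finally show ?thesis
        by (rule power2_le_imp_le) (use K0 q in auto)
    qed
    then have "K \<le> K * sqrt q" using K0 q unfolding K_def by (intro onorm_bound) auto
    moreover have "sqrt q < 1" using q by simp
    ultimately show False using K0 by (simp add: mult_le_cancel_left1)
  qed
  then show ?thesis using K[of v] by (meson mult_right_mono norm_ge_zero order_trans)
qed


lemma cyclic_sequence:
  fixes \<pi> :: "'a::cstar_algebra \<Rightarrow> 'h::chilbert_space \<Rightarrow> 'h"
  assumes "closure (range (\<lambda>a. \<pi> a \<Omega>)) = UNIV"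
  obtains A where "(\<lambda>k. \<pi> (A k) \<Omega>) \<longlonglongrightarrow> v"
proof -
  have "v \<in> closure (range (\<lambda>a. \<pi> a \<Omega>))" using assms by simp
  then obtain X where X: "\<And>k. X k \<in> range (\<lambda>a. \<pi> a \<Omega>)" "X \<longlonglongrightarrow> v"
    unfolding closure_sequential by blast
  from X(1) have "\<forall>k. \<exists>a. X k = \<pi> a \<Omega>" by blast
  then obtain A where "\<And>k. X k = \<pi> (A k) \<Omega>" by metis
  with X(2) that[of A] show thesis by (metis (no_types, lifting) ext)
qed

text \<open>The uniqueness part of the GNS theorem: \<open>\<pi> a \<Omega> \<mapsto> \<rho> a \<Psi>\<close> is isometric with dense domain and range.
  The extension \<open>U\<close> is the limit along a chosen approximating sequence, and the fact \<open>U\<close> below says that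
  every approximating sequence has the same limit.\<close>

lemma same_vector_state_unitarily_equivalent:
  fixes \<pi> :: "'a::cstar_algebra \<Rightarrow> 'h::chilbert_space \<Rightarrow> 'h"
    and \<rho> :: "'a \<Rightarrow> 'k::chilbert_space \<Rightarrow> 'k"
  assumes P: "star_representation \<pi>" and R: "star_representation \<rho>"
    and cycP: "closure (range (\<lambda>a. \<pi> a \<Omega>)) = UNIV"
    and cycR: "closure (range (\<lambda>a. \<rho> a \<Psi>)) = UNIV"
    and eq: "\<And>a. cinner \<Omega> (\<pi> a \<Omega>) = cinner \<Psi> (\<rho> a \<Psi>)"
  shows "unitarily_equivalent \<pi> \<rho>"
proof -
  have norm_eq: "norm (\<pi> a \<Omega> - \<pi> b \<Omega>) = norm (\<rho> a \<Psi> - \<rho> b \<Psi>)" for a b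
  proof -
    have "complex_of_real ((norm (\<pi> (a - b) \<Omega>))\<^sup>2) = complex_of_real ((norm (\<rho> (a - b) \<Psi>))\<^sup>2)"
      by (simp only: rep_norm_squared[OF P, symmetric] rep_norm_squared[OF R, symmetric] eq)
    then have "(norm (\<pi> (a - b) \<Omega>))\<^sup>2 = (norm (\<rho> (a - b) \<Psi>))\<^sup>2" by (rule of_real_eq_iff[THEN iffD1])
    then show ?thesis by (simp add: power2_eq_iff_nonneg rep_diff_alg[OF P] rep_diff_alg[OF R])
  qed
  define U where "U v = lim (\<lambda>k. \<rho> ((SOME A. (\<lambda>k. \<pi> (A k) \<Omega>) \<longlonglongrightarrow> v) k) \<Psi>)" for v
  have U: "(\<lambda>k. \<rho> (A k) \<Psi>) \<longlonglongrightarrow> U v" if A: "(\<lambda>k. \<pi> (A k) \<Omega>) \<longlonglongrightarrow> v" for A v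
  proof -
    define B where "B = (SOME A. (\<lambda>k. \<pi> (A k) \<Omega>) \<longlonglongrightarrow> v)"
    have B: "(\<lambda>k. \<pi> (B k) \<Omega>) \<longlonglongrightarrow> v"
      unfolding B_def by (rule someI[of "\<lambda>A. (\<lambda>k. \<pi> (A k) \<Omega>) \<longlonglongrightarrow> v", OF A])
    have "Cauchy (\<lambda>k. \<rho> (B k) \<Psi>)"
      using LIMSEQ_imp_Cauchy[OF B] by (simp add: Cauchy_def dist_norm norm_eq)
    then have 1: "(\<lambda>k. \<rho> (B k) \<Psi>) \<longlonglongrightarrow> U v"
      unfolding U_def B_def[symmetric] by (simp add: Cauchy_convergent_iff convergent_LIMSEQ_iff)
    have "(\<lambda>k. norm (\<pi> (A k) \<Omega> - \<pi> (B k) \<Omega>)) \<longlonglongrightarrow> 0"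
      using tendsto_diff[OF A B] by (simp add: tendsto_norm_zero_iff)
    then have "(\<lambda>k. \<rho> (A k) \<Psi> - \<rho> (B k) \<Psi>) \<longlonglongrightarrow> 0"
      by (simp add: norm_eq tendsto_norm_zero_iff)
    from tendsto_add[OF this 1] show ?thesis by simp
  qed
  have U': "U v = w" if "(\<lambda>k. \<pi> (A k) \<Omega>) \<longlonglongrightarrow> v" "(\<lambda>k. \<rho> (A k) \<Psi>) \<longlonglongrightarrow> w" for A v w
    using U[OF that(1)] that(2) LIMSEQ_unique by blast
  have lim_scaleC: "(\<lambda>k. c *\<^sub>C X k) \<longlonglongrightarrow> c *\<^sub>C x" if "X \<longlonglongrightarrow> x"
    for c and X :: "nat \<Rightarrow> 'x::chilbert_space" and x
  proof -
    have "bounded_linear (\<lambda>x::'x. c *\<^sub>C x)"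
      by (rule bounded_linear_intro[where K = "cmod c"])
         (simp_all add: scaleC_add_right scaleR_scaleC scaleC_scaleC norm_scaleC_hilbert mult.commute)
    then show ?thesis using that by (rule bounded_linear.tendsto)
  qed
  have add: "U (v + w) = U v + U w" for v w
  proof -
    obtain A where A: "(\<lambda>k. \<pi> (A k) \<Omega>) \<longlonglongrightarrow> v" using cyclic_sequence[where \<pi> = \<pi>, OF cycP] .
    obtain B where B: "(\<lambda>k. \<pi> (B k) \<Omega>) \<longlonglongrightarrow> w" using cyclic_sequence[where \<pi> = \<pi>, OF cycP] .
    show ?thesis
      using tendsto_add[OF A B] tendsto_add[OF U[OF A] U[OF B]]
      by (intro U'[of "\<lambda>k. A k + B k"]) (simp_all add: rep_add_alg[OF P] rep_add_alg[OF R])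
  qed
  have scale: "U (c *\<^sub>C v) = c *\<^sub>C U v" for c v
  proof -
    obtain A where A: "(\<lambda>k. \<pi> (A k) \<Omega>) \<longlonglongrightarrow> v" using cyclic_sequence[where \<pi> = \<pi>, OF cycP] .
    show ?thesis
      using lim_scaleC[OF A] lim_scaleC[OF U[OF A]]
      by (intro U'[of "\<lambda>k. c *\<^sub>C A k"]) (simp_all add: rep_scaleC_alg[OF P] rep_scaleC_alg[OF R])
  qed
  have inner: "cinner (U v) (U w) = cinner v w" for v w
  proof -
    obtain A where A: "(\<lambda>k. \<pi> (A k) \<Omega>) \<longlonglongrightarrow> v" using cyclic_sequence[where \<pi> = \<pi>, OF cycP] .
    have lin: "cinner (U v) (\<rho> b \<Psi>) = cinner v (\<pi> b \<Omega>)" for b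
    proof -
      have "cinner (\<rho> b \<Psi>) (\<rho> a \<Psi>) = cinner (\<pi> b \<Omega>) (\<pi> a \<Omega>)" for a
        using eq[of "star b * a"] rep_star[OF P, of "star b" \<Omega> "\<pi> a \<Omega>"]
          rep_star[OF R, of "star b" \<Psi> "\<rho> a \<Psi>"]
        by (simp add: rep_mult[OF P] rep_mult[OF R] star_star)
      with tendsto_cinner_right[OF U[OF A], of "\<rho> b \<Psi>"] tendsto_cinner_right[OF A, of "\<pi> b \<Omega>"]
      have "cinner (\<rho> b \<Psi>) (U v) = cinner (\<pi> b \<Omega>) v" using LIMSEQ_unique by fastforce
      then show ?thesis using cinner_commute[of "U v"] cinner_commute[of v] by metis
    qed
    obtain B where B: "(\<lambda>k. \<pi> (B k) \<Omega>) \<longlonglongrightarrow> w" using cyclic_sequence[where \<pi> = \<pi>, OF cycP] .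
    from tendsto_cinner_right[OF U[OF B], of "U v"] tendsto_cinner_right[OF B, of v]
    show ?thesis unfolding lin using LIMSEQ_unique by blast
  qed
  have "w \<in> range U" for w
  proof -
    obtain A where A: "(\<lambda>k. \<rho> (A k) \<Psi>) \<longlonglongrightarrow> w" using cyclic_sequence[where \<pi> = \<rho>, OF cycR] .
    have "Cauchy (\<lambda>k. \<pi> (A k) \<Omega>)"
      using LIMSEQ_imp_Cauchy[OF A] by (simp add: Cauchy_def dist_norm norm_eq)
    then obtain v where "(\<lambda>k. \<pi> (A k) \<Omega>) \<longlonglongrightarrow> v"
      using Cauchy_convergent convergent_def by blast
    from U'[OF this A] show ?thesis by blast
  qed
  moreover have "U (\<pi> a v) = \<rho> a (U v)" for a v
  proof -
    obtain A where A: "(\<lambda>k. \<pi> (A k) \<Omega>) \<longlonglongrightarrow> v" using cyclic_sequence[where \<pi> = \<pi>, OF cycP] .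
    show ?thesis
      using rep_tendsto[OF P A, of a] rep_tendsto[OF R U[OF A], of a]
      by (intro U'[of "\<lambda>k. a * A k"]) (simp_all add: rep_mult[OF P] rep_mult[OF R])
  qed
  ultimately show ?thesis
    unfolding unitarily_equivalent_def unitary_def using add scale inner by blast
qed

section \<open>Combinations of words in the Cuntz algebra\<close>

definition cuntz_lin :: "nat \<Rightarrow> ('n::finite list \<Rightarrow> complex) \<Rightarrow> 'n cuntz" where
  "cuntz_lin m x = (\<Sum>J | length J = m. x J *\<^sub>C cuntz_word J)"

lemma cuntz_word_append: "cuntz_word (J @ K) = cuntz_word J * cuntz_word K"
  by (simp add: cuntz_word_def prod_list_append_monoid)

lemma cuntz_word_Nil [simp]: "cuntz_word [] = 1"
  by (simp add: cuntz_word_def)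

lemma cuntz_word_Cons: "cuntz_word (j # J) = cuntz_gen j * cuntz_word J"
  by (simp add: cuntz_word_def)

lemma cuntz_word_orthonormal:
  "length J = length K \<Longrightarrow> star (cuntz_word J) * cuntz_word K = (if J = K then 1 else 0)"
proof (induction J K rule: list_induct2)
  case (Cons j J k K)
  have "star (cuntz_word (j # J)) * cuntz_word (k # K)
      = star (cuntz_word J) * (star (cuntz_gen j) * cuntz_gen k) * cuntz_word K"
    by (simp add: cuntz_word_Cons star_mult mult.assoc)
  also have "\<dots> = (if j = k then star (cuntz_word J) * cuntz_word K else 0)"
    by (simp add: cuntz_isometry)
  also have "\<dots> = (if j # J = k # K then 1 else 0)" unfolding Cons.IH by simp
  finally show ?case .
qed (simp add: star_one)

lemma scaleC_sum_right: "c *\<^sub>C (sum f A :: 'a::complex_vector) = (\<Sum>i\<in>A. c *\<^sub>C f i)"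
  by (induction A rule: infinite_finite_induct) (auto simp: scaleC_add_right scaleC_zero_right)

lemma star_sum: "star (sum f A :: 'a::cstar_algebra) = (\<Sum>i\<in>A. star (f i))"
  by (induction A rule: infinite_finite_induct) (auto simp: star_add star_zero)

lemma scaleC_sum_left: "(sum f A) *\<^sub>C (x :: 'a::complex_vector) = (\<Sum>i\<in>A. f i *\<^sub>C x)"
  by (induction A rule: infinite_finite_induct) (auto simp: scaleC_add_left scaleC_zero_left)

lemma cuntz_word_star_lin:
  fixes J :: "'n::finite list"
  assumes "length J = m"
  shows "star (cuntz_word J) * cuntz_lin m x = x J *\<^sub>C 1"
proof -
  have "star (cuntz_word J) * cuntz_lin m x
      = (\<Sum>K | length K = m. x K *\<^sub>C (star (cuntz_word J) * cuntz_word K))"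
    by (simp add: cuntz_lin_def sum_distrib_left scaleC_mult_right)
  also have "\<dots> = (\<Sum>K | length K = m. if J = K then x K *\<^sub>C 1 else 0)"
    using assms by (intro sum.cong) (auto simp: cuntz_word_orthonormal scaleC_zero_right)
  finally show ?thesis using assms by (simp add: sum.delta')
qed

lemma cuntz_lin_isometry:
  assumes "x \<in> unit_vectors m"
  shows "star (cuntz_lin m x) * cuntz_lin m x = 1"
proof -
  have "star (cuntz_lin m x) = (\<Sum>J | length J = m. cnj (x J) *\<^sub>C star (cuntz_word J))"
    by (simp add: cuntz_lin_def star_sum star_scaleC)
  then have "star (cuntz_lin m x) * cuntz_lin m x
      = (\<Sum>J | length J = m. (cnj (x J) * x J) *\<^sub>C 1)"
    by (simp add: sum_distrib_right scaleC_mult_left cuntz_word_star_lin scaleC_scaleC)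
  also have "\<dots> = complex_of_real (\<Sum>J | length J = m. (cmod (x J))\<^sup>2) *\<^sub>C 1"
    by (simp add: scaleC_sum_left[symmetric] mult.commute flip: complex_norm_square)
  finally show ?thesis by (simp only: unit_vectors_sum[OF assms] of_real_1 scaleC_one)
qed

lemma cuntz_lin_mult:
  assumes "x \<in> tensor_space m" "y \<in> tensor_space l"
  shows "cuntz_lin m x * cuntz_lin l y = cuntz_lin (m + l) (x \<otimes>\<^sub>v y)"
  by (simp add: cuntz_lin_def sum_words_append tensor_homogeneous(2)[OF assms] sum_product
      scaleC_mult_left scaleC_mult_right scaleC_scaleC cuntz_word_append mult.commute)

text \<open>The linear span of the words without adjoints.  It is a real span; complex coefficients are part of the
  generators.\<close>

definition cuntz_word_span :: "'n::finite cuntz set" where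
  "cuntz_word_span = span (range (\<lambda>(c, J). c *\<^sub>C cuntz_word J))"

lemma cuntz_word_span_base: "c *\<^sub>C cuntz_word J \<in> cuntz_word_span"
  unfolding cuntz_word_span_def by (intro span_base) auto

lemma cuntz_word_span_closed:
  "0 \<in> cuntz_word_span" "a \<in> cuntz_word_span \<Longrightarrow> b \<in> cuntz_word_span \<Longrightarrow> a + b \<in> cuntz_word_span"
  by (simp_all add: cuntz_word_span_def span_zero span_add)

lemma cuntz_word_span_sum:
  "(\<And>i. i \<in> A \<Longrightarrow> f i \<in> cuntz_word_span) \<Longrightarrow> sum f A \<in> cuntz_word_span"
  unfolding cuntz_word_span_def by (rule span_sum)

lemma cuntz_word_span_induct [consumes 1, case_names zero word add]:
  assumes "b \<in> cuntz_word_span" and "P 0" and word: "\<And>c J. P (c *\<^sub>C cuntz_word J)"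
    and add: "\<And>a b. P a \<Longrightarrow> P b \<Longrightarrow> P (a + b)"
  shows "P b"
  using assms(1) unfolding cuntz_word_span_def
proof (induction rule: span_induct_alt)
  case base
  show ?case by fact
next
  case (step r x y)
  then obtain c J where "x = c *\<^sub>C cuntz_word J" by auto
  then have "r *\<^sub>R x = (complex_of_real r * c) *\<^sub>C cuntz_word J"
    by (simp add: scaleR_scaleC scaleC_scaleC)
  with step word add show ?case by metis
qed

text \<open>The elements that agree with a combination of words modulo the left ideal generated by \<open>e - 1\<close>, hence
  act like one on every vector fixed by \<open>e\<close>, in every representation.\<close>

definition reducible_by :: "'n::finite cuntz \<Rightarrow> 'n cuntz set" where
  "reducible_by e = {a. \<exists>b \<in> cuntz_word_span. \<exists>c. a = b + c * (e - 1)}"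

lemma reducible_byI: "b \<in> cuntz_word_span \<Longrightarrow> a = b + c * (e - 1) \<Longrightarrow> a \<in> reducible_by e"
  unfolding reducible_by_def by blast

lemma reducible_by_span: "b \<in> cuntz_word_span \<Longrightarrow> b \<in> reducible_by e"
  by (rule reducible_byI[where c = 0]) auto

lemma reducible_by_add:
  assumes "a \<in> reducible_by e" "a' \<in> reducible_by e"
  shows "a + a' \<in> reducible_by e"
proof -
  obtain b c b' c' where "b \<in> cuntz_word_span" "b' \<in> cuntz_word_span"
    "a = b + c * (e - 1)" "a' = b' + c' * (e - 1)"
    using assms unfolding reducible_by_def by blast
  then show ?thesis
    by (intro reducible_byI[of "b + b'" _ "c + c'"] cuntz_word_span_closed)
       (simp_all add: distrib_right)
qed

lemma reducible_by_left_mult: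
  assumes words: "\<And>c J. c *\<^sub>C (x * cuntz_word J) \<in> reducible_by e"
    and "a \<in> reducible_by e"
  shows "x * a \<in> reducible_by e"
proof -
  obtain b c where b: "b \<in> cuntz_word_span" and a: "a = b + c * (e - 1)"
    using assms(2) unfolding reducible_by_def by blast
  have "x * b \<in> reducible_by e"
    using b
  proof (induction rule: cuntz_word_span_induct)
    case zero
    show ?case using reducible_by_span[OF cuntz_word_span_closed(1)] by simp
  next
    case (word c J)
    show ?case using words by (simp add: scaleC_mult_right)
  next
    case (add a b)
    then show ?case by (simp add: distrib_left reducible_by_add)
  qed
  then obtain b' c' where "b' \<in> cuntz_word_span" "x * b = b' + c' * (e - 1)"
    unfolding reducible_by_def by blast
  then show ?thesis
    by (intro reducible_byI[of b' _ "c' + x * c"])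
       (simp_all add: a distrib_left distrib_right mult.assoc)
qed

text \<open>Induction on letters.  The adjoint of a generator cancels against the first letter of a nonempty word;
  at the empty word it is absorbed by \<open>s\<^sub>i\<^sup>* \<equiv> s\<^sub>i\<^sup>* s(z)\<close>, as all words in \<open>s(z)\<close> are nonempty.\<close>

lemma reducible_by_cuntz_lin:
  fixes a :: "'n::finite free"
  assumes "1 \<le> m"
  shows "cuntz_of a \<in> reducible_by (cuntz_lin m z)"
proof -
  let ?R = "reducible_by (cuntz_lin m z)"
  have zero_span: "0 \<in> (cuntz_word_span :: 'n cuntz set)" by (rule cuntz_word_span_closed(1))
  have gen: "c *\<^sub>C (cuntz_gen i * cuntz_word J) \<in> ?R" for c i J
    using reducible_by_span[OF cuntz_word_span_base[of c "i # J"]] by (simp add: cuntz_word_Cons)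
  have star_gen: "c *\<^sub>C (star (cuntz_gen i) * cuntz_word J) \<in> ?R" for c i J
  proof (cases J)
    case (Cons j J')
    have "star (cuntz_gen i) * cuntz_word J = (if i = j then 1 else 0) * cuntz_word J'"
      unfolding Cons cuntz_word_Cons mult.assoc[symmetric] cuntz_isometry ..
    then show ?thesis
      using reducible_by_span[OF cuntz_word_span_base[of c J']]
        reducible_by_span[OF zero_span]
      by (simp add: scaleC_zero_right)
  next
    case Nil
    have split: "c *\<^sub>C star (cuntz_gen i) = c *\<^sub>C (star (cuntz_gen i) * cuntz_lin m z)
        + ((- c) *\<^sub>C star (cuntz_gen i)) * (cuntz_lin m z - 1)"
    proof -
      have "(- c) *\<^sub>C x = - (c *\<^sub>C x)" for x :: "'n cuntz"
        using scaleC_scaleC[of "- 1" c x] by (simp add: scaleC_minus_one)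
      then show ?thesis by (simp add: scaleC_mult_left right_diff_distrib)
    qed
    have "c *\<^sub>C (star (cuntz_gen i) * (z K *\<^sub>C cuntz_word K)) \<in> cuntz_word_span"
      if lenK: "length K = m" for K
    proof -
      obtain k K' where K: "K = k # K'" using lenK assms by (cases K) auto
      have "star (cuntz_gen i) * cuntz_word K = (if i = k then 1 else 0) * cuntz_word K'"
        unfolding K cuntz_word_Cons mult.assoc[symmetric] cuntz_isometry ..
      then show ?thesis
        using cuntz_word_span_base[of "c * z K" K'] zero_span
        by (simp add: scaleC_mult_right scaleC_scaleC scaleC_zero_right)
    qed
    then have "c *\<^sub>C (star (cuntz_gen i) * cuntz_lin m z) \<in> cuntz_word_span"
      unfolding cuntz_lin_def sum_distrib_left scaleC_sum_right
      by (intro cuntz_word_span_sum) simp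
    with split show ?thesis unfolding Nil by (auto intro: reducible_byI)
  qed
  have letter: "c *\<^sub>C (cuntz_of (Poly_Mapping.single (Word [l]) 1) * cuntz_word J) \<in> ?R" for c l J
  proof (cases l)
    case (Gen i)
    with gen show ?thesis by (simp add: cuntz_gen_def fgen_def)
  next
    case (GenStar i)
    then have "Poly_Mapping.single (Word [l]) 1 = fstar (fgen i)"
      by (simp add: fgen_def fstar_single)
    with star_gen show ?thesis by (simp add: cuntz_of_fstar cuntz_gen_def)
  qed
  have word: "cuntz_of (Poly_Mapping.single (Word u) c) \<in> ?R" for u c
  proof (induction u)
    case Nil
    have "Poly_Mapping.single (Word []) c = fscale c (1 :: 'n free)"
      by (simp add: fscale_def zero_word_def)
    then show ?case
      using reducible_by_span[OF cuntz_word_span_base[of c "[]"]] by (simp add: cuntz_of_fscale)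
  next
    case (Cons l u)
    have "Poly_Mapping.single (Word (l # u)) c
        = Poly_Mapping.single (Word [l]) 1 * Poly_Mapping.single (Word u) c"
      by (simp add: mult_single)
    then show ?case
      using reducible_by_left_mult[OF letter Cons] by (simp add: cuntz_of_mult)
  qed
  show ?thesis
  proof (induction a rule: free_induct)
    case zero
    show ?case using reducible_by_span[OF zero_span] by simp
  next
    case (single w c)
    then show ?case using word by (cases w) simp
  next
    case (add a b)
    then show ?case by (simp add: cuntz_of_add reducible_by_add)
  qed
qed

section \<open>Fixed vectors and their correlations\<close>

lemma cuntz_lin_fixed_adjoint:
  assumes R: "star_representation \<pi>" and fixed: "\<pi> (cuntz_lin m z) \<Omega> = \<Omega>" and "length J = m"
  shows "\<pi> (star (cuntz_word J)) \<Omega> = z J *\<^sub>C \<Omega>"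
proof -
  have "\<pi> (star (cuntz_word J)) \<Omega> = \<pi> (star (cuntz_word J) * cuntz_lin m z) \<Omega>"
    by (simp add: rep_mult[OF R] fixed)
  then show ?thesis
    by (simp add: cuntz_word_star_lin[OF \<open>length J = m\<close>] rep_scaleC_alg[OF R] rep_one[OF R])
qed

text \<open>\<open>\<langle>\<Omega>, s(z) \<Omega>\<rangle> = \<Sum> z\<^sub>J \<omega>(s\<^sub>J) = \<parallel>z\<parallel>\<^sup>2 = 1\<close>, and \<open>\<Omega>\<close> and \<open>s(z) \<Omega>\<close> are unit vectors, so they coincide.\<close>

lemma sub_cuntz_state_fixed:
  assumes "sub_cuntz_state z \<omega>" and "gns_triple \<omega> \<pi> \<Omega>" and z: "z \<in> unit_vectors m"
  shows "norm \<Omega> = 1" and "\<pi> (cuntz_lin m z) \<Omega> = \<Omega>"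
proof -
  have R: "star_representation \<pi>" and \<omega>: "\<And>a. \<omega> a = cinner \<Omega> (\<pi> a \<Omega>)"
    using assms(2) by (auto simp: gns_triple_def)
  obtain m' where "z \<in> unit_vectors m'"
    and "\<And>J. length J = m' \<Longrightarrow> \<omega> (cuntz_word J) = cnj (z J)"
    using assms(1) unfolding sub_cuntz_state_def by blast
  moreover from this z have "m' = m"
    by (meson tensor_space_degree_unique unit_vectors_nonzero unit_vectors_tensor_space)
  ultimately have val: "\<And>J. length J = m \<Longrightarrow> \<omega> (cuntz_word J) = cnj (z J)" by simp
  have "\<omega> 1 = 1" using assms(1) by (simp add: sub_cuntz_state_def is_state_def)
  then have "complex_of_real ((norm \<Omega>)\<^sup>2) = 1"
    by (simp add: \<omega> rep_one[OF R] flip: cinner_self del: of_real_power)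
  then have "(norm \<Omega>)\<^sup>2 = 1" by (simp only: of_real_eq_1_iff)
  then show n: "norm \<Omega> = 1" by (simp add: power2_eq_1_iff) (use norm_ge_zero[of \<Omega>] in linarith)
  let ?e = "cuntz_lin m z"
  have "complex_of_real ((norm (\<pi> ?e \<Omega>))\<^sup>2) = complex_of_real 1"
    using rep_norm_squared[OF R, of \<Omega> ?e] n
    by (simp add: cuntz_lin_isometry[OF z] rep_one[OF R] cinner_self)
  then have ne: "(norm (\<pi> ?e \<Omega>))\<^sup>2 = 1" by (rule of_real_eq_iff[THEN iffD1])
  have "cinner \<Omega> (\<pi> ?e \<Omega>) = (\<Sum>J | length J = m. z J * cnj (z J))"
    by (simp add: cuntz_lin_def rep_sum_alg[OF R] rep_scaleC_alg[OF R] cinner_sum_right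
        cinner_scaleC_right \<omega>[symmetric] val)
  also have "\<dots> = complex_of_real (\<Sum>J | length J = m. (cmod (z J))\<^sup>2)"
    unfolding of_real_sum complex_norm_square ..
  also have "\<dots> = 1" by (simp only: unit_vectors_sum[OF z] of_real_1)
  finally have "(norm (\<Omega> - \<pi> ?e \<Omega>))\<^sup>2 = 0" by (simp add: norm_diff_squared n ne)
  then show "\<pi> ?e \<Omega> = \<Omega>" by simp
qed

lemma
  assumes R: "star_representation \<pi>"
  shows word_correlation_left:
      "\<pi> (cuntz_lin l y) \<Psi> = \<Psi> \<Longrightarrow> length K = l \<Longrightarrow>
       cinner (\<pi> (cuntz_word (K @ J)) \<Omega>) \<Psi> = y K * cinner (\<pi> (cuntz_word J) \<Omega>) \<Psi>"
    and word_correlation_right: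
      "\<pi> (cuntz_lin m z) \<Omega> = \<Omega> \<Longrightarrow> cinner (\<pi> (cuntz_word J) \<Omega>) \<Psi> =
       (\<Sum>K | length K = m. cnj (z K) * cinner (\<pi> (cuntz_word (J @ K)) \<Omega>) \<Psi>)"
proof -
  assume "\<pi> (cuntz_lin l y) \<Psi> = \<Psi>" "length K = l"
  from cuntz_lin_fixed_adjoint[OF R this]
  show "cinner (\<pi> (cuntz_word (K @ J)) \<Omega>) \<Psi> = y K * cinner (\<pi> (cuntz_word J) \<Omega>) \<Psi>"
    using rep_star[OF R, of "star (cuntz_word K)" "\<pi> (cuntz_word J) \<Omega>" \<Psi>]
    by (simp add: star_star cuntz_word_append rep_mult[OF R] cinner_scaleC_right)
next
  assume fixed: "\<pi> (cuntz_lin m z) \<Omega> = \<Omega>"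
  have "\<pi> (cuntz_word J) \<Omega> = \<pi> (cuntz_word J * cuntz_lin m z) \<Omega>"
    by (simp add: rep_mult[OF R] fixed)
  also have "\<dots> = (\<Sum>K | length K = m. z K *\<^sub>C \<pi> (cuntz_word (J @ K)) \<Omega>)"
    by (simp add: cuntz_lin_def sum_distrib_left scaleC_mult_right rep_sum_alg[OF R]
        rep_scaleC_alg[OF R] cuntz_word_append)
  finally show "cinner (\<pi> (cuntz_word J) \<Omega>) \<Psi> =
       (\<Sum>K | length K = m. cnj (z K) * cinner (\<pi> (cuntz_word (J @ K)) \<Omega>) \<Psi>)"
    by (simp add: cinner_sum_left cinner_scaleC_left)
qed

lemma rep_tendsto_alg:
  fixes A :: "nat \<Rightarrow> 'a::cstar_algebra"
  assumes R: "star_representation \<pi>" and "A \<longlonglongrightarrow> a"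
  shows "(\<lambda>k. \<pi> (A k) v) \<longlonglongrightarrow> \<pi> a v"
proof -
  have "bounded_linear (\<lambda>a. \<pi> a v)"
    by (rule bounded_linear_intro[where K = "norm v"])
       (simp_all add: rep_add_alg[OF R] scaleR_scaleC rep_scaleC_alg[OF R] rep_contractive[OF R])
  then show ?thesis using assms(2) by (rule bounded_linear.tendsto)
qed

text \<open>Through \<open>reducible_by\<close> the values at words determine the values on the dense *-subalgebra, and by
  \<open>rep_contractive\<close> these determine all others.\<close>

lemma word_values_determine_matrix_coefficients:
  fixes \<pi> :: "'n::finite cuntz \<Rightarrow> 'h::chilbert_space \<Rightarrow> 'h"
    and \<rho> :: "'n cuntz \<Rightarrow> 'k::chilbert_space \<Rightarrow> 'k"
  assumes P: "star_representation \<pi>" and R: "star_representation \<rho>" and "1 \<le> m"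
    and fixP: "\<pi> (cuntz_lin m z) \<Omega> = \<Omega>" and fixR: "\<rho> (cuntz_lin m z) \<Omega>' = \<Omega>'"
    and words: "\<And>J. cinner \<Psi> (\<pi> (cuntz_word J) \<Omega>) = cinner \<Psi>' (\<rho> (cuntz_word J) \<Omega>')"
  shows "cinner \<Psi> (\<pi> a \<Omega>) = cinner \<Psi>' (\<rho> a \<Omega>')"
proof -
  have span: "cinner \<Psi> (\<pi> b \<Omega>) = cinner \<Psi>' (\<rho> b \<Omega>')" if "b \<in> cuntz_word_span" for b
    using that
    by (induction rule: cuntz_word_span_induct)
       (simp_all add: rep_zero_alg[OF P] rep_zero_alg[OF R] rep_add_alg[OF P] rep_add_alg[OF R]
         rep_scaleC_alg[OF P] rep_scaleC_alg[OF R] cinner_scaleC_right cinner_add_right words)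
  have free: "cinner \<Psi> (\<pi> (cuntz_of f) \<Omega>) = cinner \<Psi>' (\<rho> (cuntz_of f) \<Omega>')" for f
  proof -
    obtain b c where b: "b \<in> cuntz_word_span" "cuntz_of f = b + c * (cuntz_lin m z - 1)"
      using reducible_by_cuntz_lin[OF \<open>1 \<le> m\<close>, of f z] unfolding reducible_by_def by blast
    have "\<pi> (cuntz_of f) \<Omega> = \<pi> b \<Omega>" "\<rho> (cuntz_of f) \<Omega>' = \<rho> b \<Omega>'"
      by (simp_all add: b(2) rep_add_alg[OF P] rep_add_alg[OF R] rep_mult[OF P] rep_mult[OF R]
          rep_diff_alg[OF P] rep_diff_alg[OF R] rep_one[OF P] rep_one[OF R] fixP fixR
          rep_zero[OF P] rep_zero[OF R])
    with span[OF b(1)] show ?thesis by simp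
  qed
  obtain A where A: "(\<lambda>k. cuntz_of (A k)) \<longlonglongrightarrow> a" using cuntz_of_dense_sequence .
  from tendsto_cinner_right[OF rep_tendsto_alg[OF P A], of \<Psi> \<Omega>]
  have "(\<lambda>k. cinner \<Psi>' (\<rho> (cuntz_of (A k)) \<Omega>')) \<longlonglongrightarrow> cinner \<Psi> (\<pi> a \<Omega>)"
    by (simp only: free)
  then show ?thesis
    using tendsto_cinner_right[OF rep_tendsto_alg[OF R A]] by (rule LIMSEQ_unique)
qed

text \<open>By induction on the length of the word: leading blocks of length \<open>m\<close> are split off with the recursion
  in \<open>z\<close>, and what remains is the empty word or a word of length below \<open>m\<close>, where the value vanishes.\<close>

lemma nonperiodic_fixed_vector_state_unique:
  fixes \<pi> :: "'n::finite cuntz \<Rightarrow> 'h::chilbert_space \<Rightarrow> 'h"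
    and \<rho> :: "'n cuntz \<Rightarrow> 'k::chilbert_space \<Rightarrow> 'k"
  assumes P: "star_representation \<pi>" and R: "star_representation \<rho>"
    and "1 \<le> m" and z: "z \<in> unit_vectors m" and "nonperiodic z"
    and fixP: "\<pi> (cuntz_lin m z) \<Omega> = \<Omega>" and fixR: "\<rho> (cuntz_lin m z) \<Psi> = \<Psi>"
    and norm: "norm \<Omega> = 1" "norm \<Psi> = 1"
  shows "cinner \<Omega> (\<pi> a \<Omega>) = cinner \<Psi> (\<rho> a \<Psi>)"
proof (rule word_values_determine_matrix_coefficients[OF P R \<open>1 \<le> m\<close> fixP fixR])
  fix J
  have "cinner (\<pi> (cuntz_word J) \<Omega>) \<Omega> = cinner (\<rho> (cuntz_word J) \<Psi>) \<Psi>"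
  proof (induction "length J" arbitrary: J rule: less_induct)
    case less
    consider "length J = 0" | "0 < length J" "length J < m" | "m \<le> length J" by linarith
    then show ?case
    proof cases
      case 1
      then show ?thesis by (simp add: rep_one[OF P] rep_one[OF R] cinner_self norm)
    next
      case 2
      note vanish = self_correlation_vanishes[OF z \<open>1 \<le> m\<close> \<open>nonperiodic z\<close> _ _ 2]
      have "cinner (\<pi> (cuntz_word J) \<Omega>) \<Omega> = 0"
        by (rule vanish[OF word_correlation_left[OF P fixP] word_correlation_right[OF P fixP]])
      moreover have "cinner (\<rho> (cuntz_word J) \<Psi>) \<Psi> = 0"
        by (rule vanish[OF word_correlation_left[OF R fixR] word_correlation_right[OF R fixR]])
      ultimately show ?thesis by simp
    next
      case 3
      then have "length (take m J) = m" "length (drop m J) < length J" using \<open>1 \<le> m\<close> by auto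
      with word_correlation_left[OF P fixP, of "take m J" "drop m J" \<Omega>]
        word_correlation_left[OF R fixR, of "take m J" "drop m J" \<Psi>]
        less[of "drop m J"] show ?thesis by simp
    qed
  qed
  then show "cinner \<Omega> (\<pi> (cuntz_word J) \<Omega>) = cinner \<Psi> (\<rho> (cuntz_word J) \<Psi>)"
    using cinner_commute by metis
qed

text \<open>If all correlations vanished, \<open>\<Psi>\<close> would be orthogonal to the dense subspace generated by \<open>\<Omega>\<close>.\<close>

lemma fixed_vectors_conjugates:
  fixes \<pi> :: "'n::finite cuntz \<Rightarrow> 'h::chilbert_space \<Rightarrow> 'h"
  assumes R: "star_representation \<pi>" and cyc: "closure (range (\<lambda>a. \<pi> a \<Omega>)) = UNIV"
    and z: "z \<in> unit_vectors m" and y: "y \<in> unit_vectors l" and "1 \<le> l" "1 \<le> m"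
    and "nonperiodic z"
    and fixz: "\<pi> (cuntz_lin m z) \<Omega> = \<Omega>" and fixy: "\<pi> (cuntz_lin l y) \<Psi> = \<Psi>"
    and "\<Psi> \<noteq> 0"
  obtains k x u where "k < l" "x \<in> tensor_space k" "x \<noteq> (\<lambda>_. 0)" "u \<in> tensor_space (l - k)"
    "y = x \<otimes>\<^sub>v u" "m dvd l" "m = l \<Longrightarrow> z = u \<otimes>\<^sub>v x"
proof -
  have "\<exists>J. cinner (\<pi> (cuntz_word J) \<Omega>) \<Psi> \<noteq> 0"
  proof (rule ccontr)
    assume "\<not> ?thesis"
    then have "cinner \<Psi> (\<pi> (cuntz_word J) \<Omega>) = cinner 0 (\<pi> (cuntz_word J) \<Omega>)" for J
      using cinner_commute[of \<Psi> "\<pi> (cuntz_word J) \<Omega>"] by simp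
    from word_values_determine_matrix_coefficients[OF R R \<open>1 \<le> m\<close> fixz fixz this]
    have 0: "cinner \<Psi> (\<pi> a \<Omega>) = 0" for a by simp
    obtain A where A: "(\<lambda>k. \<pi> (A k) \<Omega>) \<longlonglongrightarrow> \<Psi>" using cyclic_sequence[where \<pi> = \<pi>, OF cyc] .
    from tendsto_cinner_right[OF this, of \<Psi>] have "cinner \<Psi> \<Psi> = 0"
      by (simp add: 0 LIMSEQ_const_iff)
    with \<open>\<Psi> \<noteq> 0\<close> show False by (simp add: cinner_self)
  qed
  then obtain J0 where "cinner (\<pi> (cuntz_word J0) \<Omega>) \<Psi> \<noteq> 0" ..
  from correlation_conjugates[OF z y \<open>1 \<le> l\<close> \<open>1 \<le> m\<close> \<open>nonperiodic z\<close>
      word_correlation_left[OF R fixy] word_correlation_right[OF R fixz] this] that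
  show thesis by blast
qed

theorem theorem1p7:
  fixes z y :: "'n::finite list \<Rightarrow> complex"
    and \<omega>z \<omega>y :: "'n cuntz \<Rightarrow> complex"
    and \<pi>z :: "'n cuntz \<Rightarrow> 'h::chilbert_space \<Rightarrow> 'h" and \<Omega>z :: 'h
    and \<pi>y :: "'n cuntz \<Rightarrow> 'k::chilbert_space \<Rightarrow> 'k" and \<Omega>y :: 'k
  assumes "2 \<le> CARD('n)"
    and "z \<in> (\<Union>m\<in>{1..}. unit_vectors m)" and "y \<in> (\<Union>m\<in>{1..}. unit_vectors m)"
    and "nonperiodic z" and "nonperiodic y"
    and "sub_cuntz_state z \<omega>z" and "sub_cuntz_state y \<omega>y"
    and "gns_triple \<omega>z \<pi>z \<Omega>z" and "gns_triple \<omega>y \<pi>y \<Omega>y"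
  shows "unitarily_equivalent \<pi>z \<pi>y \<longleftrightarrow>
    z = y \<or>
    (\<exists>x1 \<in> (\<Union>m\<in>{1..}. unit_vectors m). \<exists>x2 \<in> (\<Union>m\<in>{1..}. unit_vectors m).
      z = x1 \<otimes>\<^sub>v x2 \<and> y = x2 \<otimes>\<^sub>v x1)"
proof -
  obtain m where "1 \<le> m" and z: "z \<in> unit_vectors m" using assms(2) by auto
  obtain l where "1 \<le> l" and y: "y \<in> unit_vectors l" using assms(3) by auto
  have Rz: "star_representation \<pi>z" and cycz: "closure (range (\<lambda>a. \<pi>z a \<Omega>z)) = UNIV"
    using assms(8) by (auto simp: gns_triple_def)
  have Ry: "star_representation \<pi>y" and cycy: "closure (range (\<lambda>a. \<pi>y a \<Omega>y)) = UNIV"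
    using assms(9) by (auto simp: gns_triple_def)
  note nz = sub_cuntz_state_fixed(1)[OF assms(6,8) z] and fixz = sub_cuntz_state_fixed(2)[OF assms(6,8) z]
  note ny = sub_cuntz_state_fixed(1)[OF assms(7,9) y] and fixy = sub_cuntz_state_fixed(2)[OF assms(7,9) y]
  show ?thesis
  proof
    assume "unitarily_equivalent \<pi>z \<pi>y"
    then obtain U where "unitary U" and U: "\<And>a v. U (\<pi>z a v) = \<pi>y a (U v)"
      unfolding unitarily_equivalent_def by blast
    then have inner: "cinner (U v) (U w) = cinner v w" and diff: "U (v - w) = U v - U w"
      and "surj U" for v w
      unfolding unitary_def by (auto simp: eq_diff_eq) (metis add_diff_cancel_right' diff_add_cancel)
    have norm: "norm (U v) = norm v" for v
    proof -
      have "complex_of_real ((norm (U v))\<^sup>2) = complex_of_real ((norm v)\<^sup>2)"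
        by (simp only: cinner_self[symmetric] inner)
      then have "(norm (U v))\<^sup>2 = (norm v)\<^sup>2" by (rule of_real_eq_iff[THEN iffD1])
      then show ?thesis by (simp add: power2_eq_iff_nonneg)
    qed
    \<comment> \<open>Each fixed vector is compared with the other one in the representation in which it is cyclic.\<close>
    obtain \<Psi> where \<Psi>: "U \<Psi> = \<Omega>y" using \<open>surj U\<close> by (metis surjD)
    have "norm (\<pi>z (cuntz_lin l y) \<Psi> - \<Psi>) = 0"
      unfolding norm[symmetric] by (simp add: diff U \<Psi> fixy)
    then have fix\<Psi>: "\<pi>z (cuntz_lin l y) \<Psi> = \<Psi>" by simp
    have "norm \<Psi> = 1" using norm[of \<Psi>] ny \<Psi> by simp
    then have "\<Psi> \<noteq> 0" by auto
    have fixU: "\<pi>y (cuntz_lin m z) (U \<Omega>z) = U \<Omega>z" using U[of "cuntz_lin m z" \<Omega>z] fixz by simp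
    have "U \<Omega>z \<noteq> 0" using norm[of \<Omega>z] nz by auto
    obtain k x u where x: "k < l" "x \<in> tensor_space k" "x \<noteq> (\<lambda>_. 0)" "u \<in> tensor_space (l - k)"
      and yxu: "y = x \<otimes>\<^sub>v u" and "m dvd l" and zux: "m = l \<Longrightarrow> z = u \<otimes>\<^sub>v x"
      using fixed_vectors_conjugates[OF Rz cycz z y \<open>1 \<le> l\<close> \<open>1 \<le> m\<close> assms(4) fixz fix\<Psi> \<open>\<Psi> \<noteq> 0\<close>] by blast
    have "l dvd m"
      using fixed_vectors_conjugates[OF Ry cycy y z \<open>1 \<le> m\<close> \<open>1 \<le> l\<close> assms(5) fixy fixU \<open>U \<Omega>z \<noteq> 0\<close>] by blast
    with \<open>m dvd l\<close> have "m = l" by (simp add: dvd_antisym)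
    note zux = zux[OF this]
    show "z = y \<or> (\<exists>x1 \<in> (\<Union>m\<in>{1..}. unit_vectors m). \<exists>x2 \<in> (\<Union>m\<in>{1..}. unit_vectors m).
      z = x1 \<otimes>\<^sub>v x2 \<and> y = x2 \<otimes>\<^sub>v x1)"
    proof (cases "k = 0")
      case True
      with x(2) have "z = y"
        by (simp add: zux yxu tensor_degree_zero_left tensor_degree_zero_right)
      then show ?thesis ..
    next
      case False
      obtain x' u' where x': "x' \<in> unit_vectors k" "u' \<in> unit_vectors (l - k)"
        and "x \<otimes>\<^sub>v u = x' \<otimes>\<^sub>v u'" "u \<otimes>\<^sub>v x = u' \<otimes>\<^sub>v x'"
        using normalize_factors[OF x(2,4)] y yxu by blast
      moreover from x' False \<open>k < l\<close> have "x' \<in> (\<Union>m\<in>{1..}. unit_vectors m)"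
        "u' \<in> (\<Union>m\<in>{1..}. unit_vectors m)" by force+
      ultimately show ?thesis unfolding yxu zux by blast
    qed
  next
    assume "z = y \<or> (\<exists>x1 \<in> (\<Union>m\<in>{1..}. unit_vectors m). \<exists>x2 \<in> (\<Union>m\<in>{1..}. unit_vectors m).
      z = x1 \<otimes>\<^sub>v x2 \<and> y = x2 \<otimes>\<^sub>v x1)"
    then have "\<exists>\<Psi>. norm \<Psi> = 1 \<and> \<pi>z (cuntz_lin l y) \<Psi> = \<Psi>
        \<and> closure (range (\<lambda>a. \<pi>z a \<Psi>)) = UNIV"
    proof (elim disjE bexE conjE)
      assume "z = y"
      then have "m = l"
        using z y by (meson tensor_space_degree_unique unit_vectors_nonzero unit_vectors_tensor_space)
      with \<open>z = y\<close> nz fixz cycz show ?thesis by blast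
    next
      fix x1 x2 :: "'n list \<Rightarrow> complex"
      assume "x1 \<in> (\<Union>m\<in>{1..}. unit_vectors m)" "x2 \<in> (\<Union>m\<in>{1..}. unit_vectors m)"
        and eqs: "z = x1 \<otimes>\<^sub>v x2" "y = x2 \<otimes>\<^sub>v x1"
      then obtain p q where x1: "x1 \<in> unit_vectors p" and x2: "x2 \<in> unit_vectors q" by auto
      note T1 = unit_vectors_tensor_space[OF x1] and T2 = unit_vectors_tensor_space[OF x2]
      have m: "m = p + q" and l: "l = q + p"
        using tensor_homogeneous(1)[OF T1 T2] tensor_homogeneous(1)[OF T2 T1] z y eqs
        by (metis tensor_space_degree_unique unit_vectors_nonzero unit_vectors_tensor_space)+
      let ?s1 = "cuntz_lin p x1" and ?s2 = "cuntz_lin q x2"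
      \<comment> \<open>As \<open>z = x\<^sub>1 \<otimes> x\<^sub>2\<close>, the isometry of \<open>x\<^sub>1\<close> leads from \<open>\<Psi>\<close> back to \<open>\<Omega>z\<close>.\<close>
      define \<Psi> where "\<Psi> = \<pi>z ?s2 \<Omega>z"
      have s1: "\<pi>z ?s1 \<Psi> = \<Omega>z"
        using fixz by (simp add: \<Psi>_def m eqs(1) cuntz_lin_mult[OF T1 T2, symmetric] rep_mult[OF Rz])
      have "\<pi>z (cuntz_lin l y) \<Psi> = \<Psi>"
        by (simp add: l eqs(2) cuntz_lin_mult[OF T2 T1, symmetric] rep_mult[OF Rz] s1)
           (simp add: \<Psi>_def)
      moreover have "complex_of_real ((norm \<Psi>)\<^sup>2) = complex_of_real 1"
        using rep_norm_squared[OF Rz, of \<Omega>z ?s2] nz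
        by (simp add: \<Psi>_def cuntz_lin_isometry[OF x2] rep_one[OF Rz] cinner_self)
      then have "(norm \<Psi>)\<^sup>2 = 1" by (rule of_real_eq_iff[THEN iffD1])
      then have "norm \<Psi> = 1" by (simp add: power2_eq_1_iff) (use norm_ge_zero[of \<Psi>] in linarith)
      moreover have "range (\<lambda>a. \<pi>z a \<Omega>z) \<subseteq> range (\<lambda>a. \<pi>z a \<Psi>)"
        by (auto simp: s1[symmetric] rep_mult[OF Rz, symmetric])
      then have "closure (range (\<lambda>a. \<pi>z a \<Psi>)) = UNIV" using cycz closure_mono by blast
      ultimately show ?thesis by blast
    qed
    then obtain \<Psi> where "norm \<Psi> = 1" "\<pi>z (cuntz_lin l y) \<Psi> = \<Psi>"
      and cyc: "closure (range (\<lambda>a. \<pi>z a \<Psi>)) = UNIV" by blast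
    then have "cinner \<Psi> (\<pi>z a \<Psi>) = cinner \<Omega>y (\<pi>y a \<Omega>y)" for a
      using nonperiodic_fixed_vector_state_unique[OF Rz Ry \<open>1 \<le> l\<close> y assms(5) _ fixy _ ny] by blast
    from same_vector_state_unitarily_equivalent[OF Rz Ry cyc cycy this]
    show "unitarily_equivalent \<pi>z \<pi>y" .
  qed
qed

end
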